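(* Let $p(D)$ be a Fourier multiplier of order $m$ on $\mathbb{T}^n$, with symbol $p:\mathbb{Z}^n\to\mathbb{C}$, and let $r\ge 0$. The following conditions are equivalent: (1) There exists a constant $K>0$ such that $|p(\xi)|\ge K|\xi|^{m-r}$ for every $\xi\in\mathbb{Z}^n\setminus\{0\}$ such that $p(\xi)\ne 0$. (2) For every $k\in\mathbb{R}$ and for every $f\in H^k(\mathbb{T}^n)\cap(\ker{}^{t}p(D)\cap C^\infty(\mathbb{T}^n))^0$, there exists $u\in H^{k+m-r}(\mathbb{T}^n)$ such that $p(D)u=f$. (3) For every $k\in\mathbb{R}$, the operator $p(D):H^{k+m-r}(\mathbb{T}^n)\to H^k(\mathbb{T}^n)$ has closed range.
   Context: $\mathbb{T}^n$ is the $n$-dimensional torus $(\mathbb{R}/2\pi\mathbb{Z})^n$, $\mathscr{D}'(\mathbb{T}^n)$ its space of distributions, and $\widehat{u}(\xi)$, $\xi\in\mathbb{Z}^n$, are the Fourier coefficients of $u$, so $u=\sum_\xi \widehat{u}(\xi)e^{ix\cdot\xi}$. For $\xi\in\mathbb{Z}^n$, $|\xi|=\sum_j|\xi_j|$ and $\|\xi\|=(\sum_j|\xi_j|^2)^{1/2}$. For $k\in\mathbb{R}$, $H^k(\mathbb{T}^n)$ is the set of $u\in\mathscr{D}'(\mathbb{T}^n)$ with $\|u\|_{H^k}^2=\sum_{\xi\in\mathbb{Z}^n}(1+\|\xi\|^2)^k|\widehat{u}(\xi)|^2<\infty$. A function $p:\mathbb{Z}^n\to\mathbb{C}$ is a symbol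 of order $m\in\mathbb{R}$ if there is a constant $C>0$ with $|p(\xi)|\le C(1+\|\xi\|^2)^{m/2}$ for all $\xi$; the Fourier multiplier of order $m$ with symbol $p$ is the operator $p(D):\mathscr{D}'(\mathbb{T}^n)\to\mathscr{D}'(\mathbb{T}^n)$ with $\widehat{p(D)u}(\xi)=p(\xi)\widehat{u}(\xi)$. The transpose ${}^{t}p(D)$ is defined through the bilinear duality bracket by $\langle p(D)u,\phi\rangle=\langle u,{}^{t}p(D)\phi\rangle$; it is the Fourier multiplier with symbol $\xi\mapsto p(-\xi)$. For a set $E\subset C^\infty(\mathbb{T}^n)$, $E^0=\{f\in\mathscr{D}'(\mathbb{T}^n):\langle f,\phi\rangle=0 \text{ for all }\phi\in E\}$. *)

theory Defs
  imports "HOL-Analysis.Analysis"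
begin

(* Functions on the torus (R/2piZ)^n are functions on real^'n that are 2pi-periodic in every
   coordinate, with n = CARD('n); frequencies are elements of int^'n. *)

definition freq_vec :: "int ^ 'n \<Rightarrow> real ^ 'n" where
  "freq_vec \<xi> = (\<chi> j. real_of_int (\<xi> $ j))"

definition l1_norm :: "int ^ 'n \<Rightarrow> real" where
  "l1_norm \<xi> = (\<Sum>j\<in>UNIV. \<bar>real_of_int (\<xi> $ j)\<bar>)"

definition l2_norm :: "int ^ 'n \<Rightarrow> real" where
  "l2_norm \<xi> = norm (freq_vec \<xi>)"

definition character :: "int ^ 'n \<Rightarrow> real ^ 'n \<Rightarrow> complex" where
  "character \<xi> x = exp (\<i> * complex_of_real (x \<bullet> freq_vec \<xi>))"

definition periodic :: "(real ^ 'n \<Rightarrow> complex) \<Rightarrow> bool" where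
  "periodic \<phi> \<longleftrightarrow> (\<forall>j x. \<phi> (x + axis j (2 * pi)) = \<phi> x)"

definition partial_deriv :: "'n \<Rightarrow> (real ^ 'n \<Rightarrow> complex) \<Rightarrow> real ^ 'n \<Rightarrow> complex" where
  "partial_deriv j \<phi> x = frechet_derivative \<phi> (at x) (axis j 1)"

(* Iterated partial derivatives, indexed by the list of the directions of differentiation. *)
definition iter_partial :: "'n list \<Rightarrow> (real ^ 'n \<Rightarrow> complex) \<Rightarrow> real ^ 'n \<Rightarrow> complex" where
  "iter_partial js \<phi> = foldr partial_deriv js \<phi>"

definition smooth :: "(real ^ 'n \<Rightarrow> complex) \<Rightarrow> bool" where
  "smooth \<phi> \<longleftrightarrow> (\<forall>js x. iter_partial js \<phi> differentiable (at x))"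

definition test_functions :: "(real ^ 'n \<Rightarrow> complex) set" where
  "test_functions = {\<phi>. smooth \<phi> \<and> periodic \<phi>}"

definition Ck_norm :: "nat \<Rightarrow> (real ^ 'n \<Rightarrow> complex) \<Rightarrow> real" where
  "Ck_norm N \<phi> = (\<Sum>js\<in>{js. length js \<le> N}. SUP x. cmod (iter_partial js \<phi> x))"

(* The bilinear bracket of u and phi is the application u phi.  A distribution takes the
   value 0 outside the test functions, so that equality in HOL is equality of distributions and
   the pointwise difference and zero of functions are those of the space of distributions. *)
definition distributions :: "((real ^ 'n \<Rightarrow> complex) \<Rightarrow> complex) set" where
  "distributions = {u.
     (\<forall>\<phi>. \<phi> \<notin> test_functions \<longrightarrow> u \<phi> = 0) \<and>
     (\<forall>\<phi>\<in>test_functions. \<forall>\<psi>\<in>test_functions. u (\<lambda>x. \<phi> x + \<psi> x) = u \<phi> + u \<psi>) \<and>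
     (\<forall>c. \<forall>\<phi>\<in>test_functions. u (\<lambda>x. c * \<phi> x) = c * u \<phi>) \<and>
     (\<exists>C N. \<forall>\<phi>\<in>test_functions. cmod (u \<phi>) \<le> C * Ck_norm N \<phi>)}"

(* Normalised so that u is the sum of the fourier_coeff u xi * character xi, where a function is
   paired with a test function through the Lebesgue integral over [0,2pi]^n. *)
definition fourier_coeff ::
    "((real ^ 'n \<Rightarrow> complex) \<Rightarrow> complex) \<Rightarrow> int ^ 'n \<Rightarrow> complex" where
  "fourier_coeff u \<xi> = u (character (- \<xi>)) / complex_of_real ((2 * pi) ^ CARD('n))"

definition sobolev :: "real \<Rightarrow> ((real ^ 'n \<Rightarrow> complex) \<Rightarrow> complex) set" where
  "sobolev k = {u \<in> distributions.
     (\<lambda>\<xi>. (1 + (l2_norm \<xi>)\<^sup>2) powr k * (cmod (fourier_coeff u \<xi>))\<^sup>2) summable_on UNIV}"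

definition sobolev_norm :: "real \<Rightarrow> ((real ^ 'n \<Rightarrow> complex) \<Rightarrow> complex) \<Rightarrow> real" where
  "sobolev_norm k u =
     sqrt (\<Sum>\<^sub>\<infinity>\<xi>. (1 + (l2_norm \<xi>)\<^sup>2) powr k * (cmod (fourier_coeff u \<xi>))\<^sup>2)"

definition sobolev_topology :: "real \<Rightarrow> ((real ^ 'n \<Rightarrow> complex) \<Rightarrow> complex) topology" where
  "sobolev_topology k = Metric_space.mtopology (sobolev k) (\<lambda>u v. sobolev_norm k (u - v))"

definition symbol_of_order :: "real \<Rightarrow> (int ^ 'n \<Rightarrow> complex) \<Rightarrow> bool" where
  "symbol_of_order m p \<longleftrightarrow>
     (\<exists>C>0. \<forall>\<xi>. cmod (p \<xi>) \<le> C * (1 + (l2_norm \<xi>)\<^sup>2) powr (m / 2))"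

(* For a symbol p of some order and a distribution u such a v exists; it is unique because the
   trigonometric polynomials are dense in the test functions. *)
definition multiplier :: "(int ^ 'n \<Rightarrow> complex) \<Rightarrow>
    ((real ^ 'n \<Rightarrow> complex) \<Rightarrow> complex) \<Rightarrow> ((real ^ 'n \<Rightarrow> complex) \<Rightarrow> complex)" where
  "multiplier p u = (THE v. v \<in> distributions \<and>
     (\<forall>\<xi>. fourier_coeff v \<xi> = p \<xi> * fourier_coeff u \<xi>))"

(* The transpose of an operator A on distributions, acting on test functions.  It is unique when
   it exists, since point evaluations are distributions; for A = multiplier p with p a symbol it
   is given by multiplication of the Fourier coefficients by p (- xi). *)
definition transpose_op ::
    "(((real ^ 'n \<Rightarrow> complex) \<Rightarrow> complex) \<Rightarrow> ((real ^ 'n \<Rightarrow> complex) \<Rightarrow> complex)) \<Rightarrow>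
     (real ^ 'n \<Rightarrow> complex) \<Rightarrow> (real ^ 'n \<Rightarrow> complex)" where
  "transpose_op A \<phi> = (THE \<psi>. \<psi> \<in> test_functions \<and> (\<forall>u\<in>distributions. A u \<phi> = u \<psi>))"

definition smooth_kernel ::
    "((real ^ 'n \<Rightarrow> complex) \<Rightarrow> (real ^ 'n \<Rightarrow> complex)) \<Rightarrow> (real ^ 'n \<Rightarrow> complex) set" where
  "smooth_kernel B = {\<phi> \<in> test_functions. B \<phi> = (\<lambda>x. 0)}"

definition annihilator ::
    "(real ^ 'n \<Rightarrow> complex) set \<Rightarrow> ((real ^ 'n \<Rightarrow> complex) \<Rightarrow> complex) set" where
  "annihilator E = {f \<in> distributions. \<forall>\<phi>\<in>E. f \<phi> = 0}"

(* Range of the operator A from H^s to H^k with maximal domain {u in H^s. A u in H^k}.  A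
   multiplier of order m maps H^(k+m-r) to H^(k-r) only, which contains H^k since r >= 0. *)
definition sobolev_range ::
    "(((real ^ 'n \<Rightarrow> complex) \<Rightarrow> complex) \<Rightarrow> ((real ^ 'n \<Rightarrow> complex) \<Rightarrow> complex)) \<Rightarrow>
     real \<Rightarrow> real \<Rightarrow> ((real ^ 'n \<Rightarrow> complex) \<Rightarrow> complex) set" where
  "sobolev_range A s k = A ` {u \<in> sobolev s. A u \<in> sobolev k}"

end

theory Submission
  imports Defs
begin

text \<open>
  Fourier series identify the test functions with the rapidly decreasing sequences on the
  frequency lattice and the distributions with the sequences of polynomial growth, so that
  \<open>p(D)\<close> and its transpose act diagonally and the annihilator of the smooth kernel consists of the
  distributions whose coefficients vanish where \<open>p\<close> does. Under (1), dividing by \<open>p\<close> solves the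
  equation. If (1) fails, \<open>p\<close> is much smaller than the weight of order \<open>m - r\<close> along a sequence of
  frequencies, and a right-hand side supported there is in \<open>H\<^sup>0\<close> while its only candidate
  solution has coefficients too large for \<open>H\<^sup>m\<^sup>-\<^sup>r\<close>. Finally, the annihilator is
  closed in \<open>H\<^sup>k\<close>, and the range contains the truncations of each of its elements to finitely many
  frequencies; hence the range is closed exactly when it is the whole annihilator.
\<close>


subsection \<open>Weights, characters and rapidly decreasing coefficients\<close>

text \<open>\<open>multiplier\<close> and \<open>transpose_op\<close> are definite descriptions, so
  acting diagonally is a statement about existence and uniqueness: existence comes from explicit
  series, uniqueness from the fact that every test function is the sum of its Fourier series. The
  crux there is that a continuous periodic function with vanishing coefficients is zero; it is
  obtained by integrating against powers of a nonnegative trigonometric polynomial with a single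
  peak per period. The bracket is bilinear, not sesquilinear: the coefficient of a distribution at
  \<xi> is read off with the character of - \<xi>, whence the reflections
  \<open>p (- \<xi>)\<close>. In the counterexample the right-hand side has coefficients
  \<open>p \<xi> * weight \<xi> powr (- s / 2)\<close> with \<open>s = m - r\<close>, so that each
  chosen frequency contributes exactly 1 to the H^s sum of the candidate solution, while the H^0 sum
  of the right-hand side converges. The lower bound in (1) does not involve k, so solvability at k =
  0 already gives it and thereby solvability for all k. The equivalence of (2) and (3), in contrast,
  holds for each k separately.\<close>

definition weight :: "int ^ 'n \<Rightarrow> real" where
  "weight \<xi> = 1 + (l2_norm \<xi>)\<^sup>2"

definition polynomial_growth :: "(int ^ 'n \<Rightarrow> complex) \<Rightarrow> bool" where
  "polynomial_growth c \<longleftrightarrow> (\<exists>C N. \<forall>\<xi>. cmod (c \<xi>) \<le> C * weight \<xi> ^ N)"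

definition rapidly_decreasing :: "(int ^ 'n \<Rightarrow> complex) \<Rightarrow> bool" where
  "rapidly_decreasing a \<longleftrightarrow> (\<forall>N. \<exists>C. \<forall>\<xi>. cmod (a \<xi>) * weight \<xi> ^ N \<le> C)"

definition fourier_series :: "(int ^ 'n \<Rightarrow> complex) \<Rightarrow> real ^ 'n \<Rightarrow> complex" where
  "fourier_series a x = (\<Sum>\<^sub>\<infinity>\<xi>. a \<xi> * character \<xi> x)"

lemma l2_norm_squared: "(l2_norm \<xi>)\<^sup>2 = (\<Sum>j\<in>UNIV. (real_of_int (\<xi> $ j))\<^sup>2)"
  by (simp add: l2_norm_def norm_vec_def L2_set_def freq_vec_def sum_nonneg)

lemma weight_ge_1: "1 \<le> weight \<xi>"
  by (simp add: weight_def)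

lemma weight_pos [simp]: "0 < weight \<xi>"
  using weight_ge_1[of \<xi>] by linarith

lemma weight_neq_0 [simp]: "weight \<xi> \<noteq> 0"
  using weight_pos[of \<xi>] by linarith

lemma weight_nonneg [simp]: "0 \<le> weight \<xi>"
  using weight_ge_1[of \<xi>] by linarith

lemma weight_minus [simp]: "weight (- \<xi>) = weight \<xi>"
  by (simp add: weight_def l2_norm_squared)

lemma component_le_weight: "1 + (real_of_int (\<xi> $ j))\<^sup>2 \<le> weight \<xi>"
  unfolding weight_def l2_norm_squared
  using member_le_sum[of j UNIV "\<lambda>j. (real_of_int (\<xi> $ j))\<^sup>2"] by auto

text \<open>From \<open>2 * t <= 1 + t^2\<close>, that is, the square of \<open>t - 1\<close> is
  nonnegative. It makes each derivative cost at most one power of the weight.\<close>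

lemma abs_component_le_weight: "\<bar>real_of_int (\<xi> $ j)\<bar> \<le> weight \<xi>"
proof -
  have "0 \<le> (\<bar>real_of_int (\<xi> $ j)\<bar> - 1)\<^sup>2" by simp
  then show ?thesis
    using component_le_weight[of \<xi> j] by (simp add: power2_eq_square algebra_simps)
qed

lemma summable_on_int_inverse_square: "(\<lambda>k::int. 1 / (1 + (real_of_int k)\<^sup>2)) summable_on UNIV"
proof -
  have nat: "(\<lambda>n::nat. 1 / (1 + (real n)\<^sup>2)) summable_on UNIV"
  proof (subst summable_on_UNIV_nonneg_real_iff)
    show "summable (\<lambda>n::nat. 1 / (1 + (real n)\<^sup>2))"
    proof (rule summable_comparison_test_ev)
      show "summable (\<lambda>n::nat. inverse (real n ^ 2))"
        using inverse_power_summable[of 2, where 'a = real] by simp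
      show "\<forall>\<^sub>F n in sequentially. norm (1 / (1 + (real n)\<^sup>2)) \<le> inverse (real n ^ 2)"
        using eventually_gt_at_top[of 0]
      proof eventually_elim
        case (elim n)
        then have "1 / (1 + (real n)\<^sup>2) \<le> 1 / (real n)\<^sup>2"
          by (intro divide_left_mono mult_pos_pos add_pos_nonneg) auto
        then show ?case by (simp add: inverse_eq_divide)
      qed
    qed
  qed auto
  have "(\<lambda>k::int. 1 / (1 + (real_of_int k)\<^sup>2)) summable_on range int"
    by (subst summable_on_reindex) (use nat in \<open>auto simp: o_def\<close>)
  moreover have "(\<lambda>k::int. 1 / (1 + (real_of_int k)\<^sup>2)) summable_on range (\<lambda>n. - int n)"
    by (subst summable_on_reindex) (use nat in \<open>auto simp: o_def inj_on_def\<close>)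
  moreover have "UNIV = range int \<union> range (\<lambda>n. - int n)"
  proof (intro set_eqI iffI UNIV_I)
    fix k :: int
    show "k \<in> range int \<union> range (\<lambda>n. - int n)"
      by (cases k rule: int_cases2) auto
  qed
  ultimately show ?thesis
    using summable_on_union by metis
qed

text \<open>The weight dominates \<open>1 + t^2\<close> for each coordinate \<open>t\<close>, so its
  power with exponent \<open>CARD('n)\<close> dominates the product of these factors, and the sum is
  controlled by a power of a one-dimensional sum.\<close>

lemma summable_inverse_weight:
  "(\<lambda>\<xi>::int ^ 'n. 1 / weight \<xi> ^ CARD('n)) summable_on UNIV"
proof (rule nonneg_bdd_above_summable_on)
  define g where "g = (\<lambda>k::int. 1 / (1 + (real_of_int k)\<^sup>2))"
  have g_nonneg: "0 \<le> g k" for k by (simp add: g_def)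
  have "sum (\<lambda>\<xi>. 1 / weight \<xi> ^ CARD('n)) A \<le> (infsum g UNIV) ^ CARD('n)"
    if "finite A" for A :: "(int ^ 'n) set"
  proof -
    \<comment> \<open>All coordinates that occur in \<open>A\<close>: then \<open>A\<close> lies in
      the cube with sides \<open>B\<close>, over which the sum of the products factors.\<close>
    define B where "B = (\<Union>j. (\<lambda>\<xi>. \<xi> $ j) ` A)"
    have "finite B" using that by (simp add: B_def)
    have "1 / weight \<xi> ^ CARD('n) \<le> (\<Prod>j\<in>UNIV. g (\<xi> $ j))" for \<xi> :: "int ^ 'n"
    proof -
      have "(\<Prod>j\<in>UNIV. 1 + (real_of_int (\<xi> $ j))\<^sup>2) \<le> (\<Prod>j\<in>(UNIV::'n set). weight \<xi>)"
        by (intro prod_mono) (auto simp: component_le_weight)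
      moreover have "0 < (\<Prod>j\<in>UNIV. 1 + (real_of_int (\<xi> $ j))\<^sup>2)"
        by (intro prod_pos) (auto simp: add_pos_nonneg)
      ultimately show ?thesis
        by (simp add: g_def prod_dividef frac_le)
    qed
    then have "sum (\<lambda>\<xi>. 1 / weight \<xi> ^ CARD('n)) A \<le> (\<Sum>\<xi>\<in>A. \<Prod>j\<in>UNIV. g (\<xi> $ j))"
      by (intro sum_mono)
    also have "\<dots> = (\<Sum>f\<in>($) ` A. \<Prod>j\<in>UNIV. g (f j))"
      by (subst sum.reindex) (auto simp: inj_on_def vec_eq_iff)
    also have "\<dots> \<le> (\<Sum>f\<in>PiE (UNIV :: 'n set) (\<lambda>_. B). \<Prod>j\<in>UNIV. g (f j))"
    proof (rule sum_mono2)
      show "finite (PiE (UNIV :: 'n set) (\<lambda>_. B))"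
        using \<open>finite B\<close> by (intro finite_PiE) auto
    qed (auto simp: B_def intro!: prod_nonneg g_nonneg)
    also have "\<dots> = (\<Prod>j\<in>(UNIV::'n set). sum g B)"
      using \<open>finite B\<close> by (subst prod_sum_PiE) auto
    also have "\<dots> = sum g B ^ CARD('n)" by simp
    also have "\<dots> \<le> (infsum g UNIV) ^ CARD('n)"
    proof (rule power_mono)
      show "sum g B \<le> infsum g UNIV"
        by (rule finite_sum_le_infsum)
          (use summable_on_int_inverse_square \<open>finite B\<close> g_nonneg in \<open>auto simp: g_def\<close>)
    qed (auto intro: sum_nonneg g_nonneg)
    finally show ?thesis .
  qed
  then show "bdd_above (sum (\<lambda>\<xi>::int ^ 'n. 1 / weight \<xi> ^ CARD('n)) ` {A. A \<subseteq> UNIV \<and> finite A})"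
    by (auto intro!: bdd_aboveI2)
qed auto

section \<open>Algebra and first-order expansion of the characters\<close>

lemma character_add: "character \<xi> (x + y) = character \<xi> x * character \<xi> y"
  by (simp add: character_def inner_add_left exp_add distrib_left flip: exp_add)

lemma character_mult: "character \<xi> x * character \<eta> x = character (\<xi> + \<eta>) x"
proof -
  have "freq_vec (\<xi> + \<eta>) = freq_vec \<xi> + freq_vec \<eta>"
    by (simp add: freq_vec_def vec_eq_iff)
  then show ?thesis
    by (simp add: character_def inner_add_right distrib_left flip: exp_add)
qed

lemma norm_character [simp]: "cmod (character \<xi> x) = 1"
  by (simp add: character_def)

lemma character_0 [simp]: "character 0 x = 1"
  by (simp add: character_def freq_vec_def inner_vec_def)

lemma character_axis: "character \<xi> (axis j t) = exp (\<i> * complex_of_real (t * real_of_int (\<xi> $ j)))"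
  by (simp add: character_def freq_vec_def inner_axis')

lemma character_axis_freq: "character (axis j k) x = exp (\<i> * complex_of_real (real_of_int k * x $ j))"
proof -
  have "freq_vec (axis j k) = axis j (real_of_int k)"
    by (simp add: freq_vec_def vec_eq_iff axis_def)
  then show ?thesis
    by (simp add: character_def inner_axis mult.commute)
qed

lemma character_periodic: "character \<xi> (x + axis j (2 * pi)) = character \<xi> x"
proof -
  have "exp (\<i> * complex_of_real (2 * pi * real_of_int k)) = 1" for k
    using exp_integer_2pi[of "of_int k"] by (simp add: mult_ac)
  then show ?thesis
    by (simp add: character_add character_axis)
qed

lemma continuous_on_character [continuous_intros]: "continuous_on S (character \<xi>)"
  unfolding character_def by (intro continuous_intros)

lemma abs_inner_freq_le: "\<bar>h \<bullet> freq_vec \<xi>\<bar> \<le> norm h * weight \<xi>"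
proof -
  have "\<bar>h \<bullet> freq_vec \<xi>\<bar> \<le> norm h * norm (freq_vec \<xi>)"
    by (rule Cauchy_Schwarz_ineq2)
  also have "norm (freq_vec \<xi>) \<le> weight \<xi>"
  proof -
    have "0 \<le> (l2_norm \<xi> - 1)\<^sup>2" by simp
    then show ?thesis
      by (simp add: weight_def l2_norm_def power2_eq_square algebra_simps)
        (smt (verit) norm_ge_zero mult_nonneg_nonneg)
  qed
  finally show ?thesis by (simp add: mult_left_mono)
qed

text \<open>The quadratic remainder costs two powers of the weight, which rapidly decreasing
  coefficients can pay when the series is differentiated term by term.\<close>

lemma character_expansion:
  "cmod (character \<xi> (x + h) - character \<xi> x - \<i> * complex_of_real (h \<bullet> freq_vec \<xi>) * character \<xi> x)
     \<le> (norm h)\<^sup>2 * (weight \<xi>)\<^sup>2"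
proof -
  define z where "z = \<i> * complex_of_real (h \<bullet> freq_vec \<xi>)"
  have "character \<xi> (x + h) - character \<xi> x - z * character \<xi> x = character \<xi> x * (exp z - (1 + z))"
    by (simp only: character_add) (simp add: z_def character_def algebra_simps)
  then have "cmod (character \<xi> (x + h) - character \<xi> x - z * character \<xi> x) = cmod (exp z - (1 + z))"
    by (simp add: norm_mult)
  \<comment> \<open>The Taylor bound carries the factor \<open>exp \<bar>Re z\<bar>\<close>, which
    is 1 because \<open>z\<close> is purely imaginary.\<close>
  also have "\<dots> \<le> (cmod z)\<^sup>2"
    using Taylor_exp[of z 1] by (simp add: z_def power2_eq_square)
  also have "cmod z = \<bar>h \<bullet> freq_vec \<xi>\<bar>"
    by (simp add: z_def norm_mult)
  also have "\<bar>h \<bullet> freq_vec \<xi>\<bar>\<^sup>2 \<le> (norm h * weight \<xi>)\<^sup>2"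
    by (intro power_mono abs_inner_freq_le) auto
  finally show ?thesis
    by (simp add: z_def power_mult_distrib)
qed

section \<open>Closure properties of the two classes of coefficients\<close>

lemma polynomial_growthI: "(\<And>\<xi>. cmod (c \<xi>) \<le> C * weight \<xi> ^ N) \<Longrightarrow> polynomial_growth c"
  by (auto simp: polynomial_growth_def)

lemma polynomial_growthE:
  assumes "polynomial_growth c"
  obtains C N where "C \<ge> 0" "\<And>\<xi>. cmod (c \<xi>) \<le> C * weight \<xi> ^ N"
proof -
  obtain C N where C: "\<And>\<xi>. cmod (c \<xi>) \<le> C * weight \<xi> ^ N"
    using assms by (auto simp: polynomial_growth_def)
  have "0 \<le> C * weight (0::int^'a) ^ N"
    using C[of 0] norm_ge_zero order_trans by blast
  then have "0 \<le> C"
    by (meson not_le mult_neg_pos weight_pos zero_less_power)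
  with C show ?thesis using that by blast
qed

lemma rapidly_decreasingE:
  assumes "rapidly_decreasing a"
  obtains C where "C \<ge> 0" "\<And>\<xi>. cmod (a \<xi>) * weight \<xi> ^ N \<le> C"
proof -
  obtain C where C: "\<And>\<xi>. cmod (a \<xi>) * weight \<xi> ^ N \<le> C"
    using assms by (auto simp: rapidly_decreasing_def)
  moreover have "0 \<le> C"
    using C[of 0] by (meson order_trans mult_nonneg_nonneg norm_ge_zero weight_nonneg zero_le_power)
  ultimately show ?thesis using that by blast
qed

lemma rapidly_decreasing_mult:
  assumes "polynomial_growth c" "rapidly_decreasing a"
  shows "rapidly_decreasing (\<lambda>\<xi>. c \<xi> * a \<xi>)"
  unfolding rapidly_decreasing_def
proof
  fix N
  obtain C M where C: "C \<ge> 0" "\<And>\<xi>. cmod (c \<xi>) \<le> C * weight \<xi> ^ M"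
    using assms(1) polynomial_growthE by blast
  obtain D where D: "D \<ge> 0" "\<And>\<xi>. cmod (a \<xi>) * weight \<xi> ^ (M + N) \<le> D"
    using assms(2) rapidly_decreasingE by blast
  have "cmod (c \<xi> * a \<xi>) * weight \<xi> ^ N \<le> C * D" for \<xi>
  proof -
    have "cmod (c \<xi> * a \<xi>) * weight \<xi> ^ N \<le> C * weight \<xi> ^ M * cmod (a \<xi>) * weight \<xi> ^ N"
      using C by (simp add: norm_mult mult_right_mono)
    also have "\<dots> = C * (cmod (a \<xi>) * weight \<xi> ^ (M + N))"
      by (simp add: power_add mult_ac)
    also have "\<dots> \<le> C * D"
      using C D by (simp add: mult_left_mono)
    finally show ?thesis .
  qed
  then show "\<exists>C. \<forall>\<xi>. cmod (c \<xi> * a \<xi>) * weight \<xi> ^ N \<le> C" by blast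
qed

lemma rapidly_decreasing_add:
  assumes "rapidly_decreasing a" "rapidly_decreasing b"
  shows "rapidly_decreasing (\<lambda>\<xi>. a \<xi> + b \<xi>)"
  unfolding rapidly_decreasing_def
proof
  fix N
  obtain C D where "\<And>\<xi>. cmod (a \<xi>) * weight \<xi> ^ N \<le> C" "\<And>\<xi>. cmod (b \<xi>) * weight \<xi> ^ N \<le> D"
    using assms rapidly_decreasingE by metis
  then have "cmod (a \<xi> + b \<xi>) * weight \<xi> ^ N \<le> C + D" for \<xi>
    using mult_right_mono[OF norm_triangle_ineq[of "a \<xi>" "b \<xi>"], of "weight \<xi> ^ N"]
    by (simp add: distrib_right) (meson add_mono order_trans)
  then show "\<exists>C. \<forall>\<xi>. cmod (a \<xi> + b \<xi>) * weight \<xi> ^ N \<le> C" by blast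
qed

lemma polynomial_growth_const: "polynomial_growth (\<lambda>_. c)"
  by (rule polynomial_growthI[of _ "cmod c" 0]) simp

lemma polynomial_growth_mult:
  assumes "polynomial_growth c" "polynomial_growth d"
  shows "polynomial_growth (\<lambda>\<xi>. c \<xi> * d \<xi>)"
proof -
  obtain C M where C: "C \<ge> 0" "\<And>\<xi>. cmod (c \<xi>) \<le> C * weight \<xi> ^ M"
    using assms(1) polynomial_growthE by blast
  obtain D N where D: "D \<ge> 0" "\<And>\<xi>. cmod (d \<xi>) \<le> D * weight \<xi> ^ N"
    using assms(2) polynomial_growthE by blast
  show ?thesis
  proof (rule polynomial_growthI)
    fix \<xi>
    have "cmod (c \<xi> * d \<xi>) \<le> (C * weight \<xi> ^ M) * (D * weight \<xi> ^ N)"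
      unfolding norm_mult using C D by (intro mult_mono) auto
    then show "cmod (c \<xi> * d \<xi>) \<le> (C * D) * weight \<xi> ^ (M + N)"
      by (simp add: power_add mult_ac)
  qed
qed

lemma polynomial_growth_minus: "polynomial_growth c \<Longrightarrow> polynomial_growth (\<lambda>\<xi>. c (- \<xi>))"
  by (metis polynomial_growth_def weight_minus)

lemma finite_support_rapidly_decreasing:
  assumes "finite {\<xi>. a \<xi> \<noteq> 0}"
  shows "rapidly_decreasing a"
  unfolding rapidly_decreasing_def
proof
  fix N
  have "cmod (a \<xi>) * weight \<xi> ^ N \<le> (\<Sum>\<xi> | a \<xi> \<noteq> 0. cmod (a \<xi>) * weight \<xi> ^ N)" for \<xi>
  proof (cases "a \<xi> = 0")
    case False
    then show ?thesis
      using assms by (intro member_le_sum) auto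
  qed (auto intro: sum_nonneg)
  then show "\<exists>C. \<forall>\<xi>. cmod (a \<xi>) * weight \<xi> ^ N \<le> C" by blast
qed

text \<open>Decay with \<open>CARD('n)\<close> additional powers of the weight leaves a multiple of
  the summable family of \<open>summable_inverse_weight\<close>.\<close>

lemma rapidly_decreasing_abs_summable:
  assumes "rapidly_decreasing (a :: int ^ 'n \<Rightarrow> complex)"
  shows "(\<lambda>\<xi>. cmod (a \<xi>) * weight \<xi> ^ N) summable_on UNIV"
proof -
  obtain C where C: "C \<ge> 0" "\<And>\<xi>. cmod (a \<xi>) * weight \<xi> ^ (N + CARD('n)) \<le> C"
    using assms rapidly_decreasingE by blast
  show ?thesis
  proof (rule summable_on_comparison_test)
    show "(\<lambda>\<xi>::int ^ 'n. C * (1 / weight \<xi> ^ CARD('n))) summable_on UNIV"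
      by (intro summable_on_cmult_right summable_inverse_weight)
    show "cmod (a \<xi>) * weight \<xi> ^ N \<le> C * (1 / weight \<xi> ^ CARD('n))" for \<xi>
      using C(2)[of \<xi>] by (simp add: power_add field_simps)
  qed auto
qed

lemma
  fixes f g :: "'a \<Rightarrow> 'b :: real_normed_vector"
  assumes "f summable_on A" "g summable_on A"
  shows summable_on_diff: "(\<lambda>x. f x - g x) summable_on A"
    and infsum_diff: "(\<Sum>\<^sub>\<infinity>x\<in>A. f x - g x) = infsum f A - infsum g A"
proof -
  have "((\<lambda>x. f x + - g x) has_sum (infsum f A + - infsum g A)) A"
    using has_sum_infsum[OF assms(1)] has_sum_infsum[OF assms(2)]
    by (intro has_sum_add) (simp_all add: has_sum_uminus)
  then show "(\<lambda>x. f x - g x) summable_on A" "(\<Sum>\<^sub>\<infinity>x\<in>A. f x - g x) = infsum f A - infsum g A"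
    by (auto simp: has_sum_iff)
qed

section \<open>Absolutely convergent Fourier series and their derivatives\<close>

lemma rapidly_decreasing_summable:
  assumes "rapidly_decreasing a"
  shows "(\<lambda>\<xi>. cmod (a \<xi>)) summable_on UNIV"
  using rapidly_decreasing_abs_summable[OF assms, of 0] by simp

lemma fourier_series_summable:
  assumes "rapidly_decreasing a"
  shows "(\<lambda>\<xi>. a \<xi> * character \<xi> x) summable_on UNIV"
  by (rule abs_summable_summable) (simp add: norm_mult rapidly_decreasing_summable[OF assms])

lemma cmod_fourier_series_le:
  assumes "rapidly_decreasing a"
  shows "cmod (fourier_series a x) \<le> (\<Sum>\<^sub>\<infinity>\<xi>. cmod (a \<xi>))"
  unfolding fourier_series_def
  by (rule order_trans[OF norm_infsum_bound])
    (simp_all add: norm_mult rapidly_decreasing_summable[OF assms])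

lemma fourier_series_add:
  assumes "rapidly_decreasing a" "rapidly_decreasing b"
  shows "fourier_series (\<lambda>\<xi>. a \<xi> + b \<xi>) x = fourier_series a x + fourier_series b x"
  unfolding fourier_series_def
  using assms by (simp add: distrib_right infsum_add fourier_series_summable)

lemma fourier_series_cmult: "fourier_series (\<lambda>\<xi>. c * a \<xi>) x = c * fourier_series a x"
  unfolding fourier_series_def by (simp add: mult.assoc infsum_cmult_right')

lemma fourier_series_delta: "fourier_series (\<lambda>\<eta>. if \<eta> = \<xi> then c else 0) x = c * character \<xi> x"
proof -
  have "fourier_series (\<lambda>\<eta>. if \<eta> = \<xi> then c else 0) x
      = (\<Sum>\<^sub>\<infinity>\<eta>\<in>{\<xi>}. c * character \<eta> x)"
    unfolding fourier_series_def by (rule infsum_cong_neutral) auto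
  then show ?thesis by simp
qed

lemma fourier_series_periodic: "fourier_series a (x + axis j (2 * pi)) = fourier_series a x"
  by (simp add: fourier_series_def character_periodic)

text \<open>Termwise differentiation without a theorem on uniform convergence: the first moment
  \<open>M1\<close> of the coefficients bounds the candidate derivative as a linear map, and the
  second moment \<open>M2\<close> bounds the remainder by \<open>M2\<close> times the square of
  \<open>norm h\<close>.\<close>

lemma fourier_series_has_derivative:
  assumes a: "rapidly_decreasing a"
  shows "(fourier_series a has_derivative
           (\<lambda>h. \<Sum>\<^sub>\<infinity>\<xi>. a \<xi> * (\<i> * complex_of_real (h \<bullet> freq_vec \<xi>) * character \<xi> x))) (at x)"
    (is "(_ has_derivative ?D) _")
proof -
  define t where "t h \<xi> = a \<xi> * (\<i> * complex_of_real (h \<bullet> freq_vec \<xi>) * character \<xi> x)" for h \<xi>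
  define M1 where "M1 = (\<Sum>\<^sub>\<infinity>\<xi>. cmod (a \<xi>) * weight \<xi>)"
  define M2 where "M2 = (\<Sum>\<^sub>\<infinity>\<xi>. cmod (a \<xi>) * (weight \<xi>)\<^sup>2)"
  have s1: "(\<lambda>\<xi>. cmod (a \<xi>) * weight \<xi>) summable_on UNIV"
    using rapidly_decreasing_abs_summable[OF a, of 1] by simp
  have s2: "(\<lambda>\<xi>. cmod (a \<xi>) * (weight \<xi>)\<^sup>2) summable_on UNIV"
    using rapidly_decreasing_abs_summable[OF a, of 2] by simp
  have t_bound: "cmod (t h \<xi>) \<le> norm h * (cmod (a \<xi>) * weight \<xi>)" for h \<xi>
    using mult_left_mono[OF abs_inner_freq_le[of h \<xi>], of "cmod (a \<xi>)"]
    by (simp add: t_def norm_mult mult_ac)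
  have t_abs: "(\<lambda>\<xi>. cmod (t h \<xi>)) summable_on UNIV" for h
    by (rule summable_on_comparison_test[OF summable_on_cmult_right[OF s1] t_bound]) auto
  have t_summable: "t h summable_on UNIV" for h
    by (rule abs_summable_summable[OF t_abs])
  have lin: "bounded_linear ?D"
  proof (rule bounded_linear_intro[where K = M1])
    fix h k :: "real ^ 'a"
    show "?D (h + k) = ?D h + ?D k"
    proof -
      have "t (h + k) = (\<lambda>\<xi>. t h \<xi> + t k \<xi>)"
        by (intro ext) (simp add: t_def inner_add_left algebra_simps)
      then have "infsum (t (h + k)) UNIV = infsum (t h) UNIV + infsum (t k) UNIV"
        using infsum_add[OF t_summable[of h] t_summable[of k]] by simp
      then show ?thesis unfolding t_def .
    qed
  next
    fix r :: real and h :: "real ^ 'a"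
    have "t (r *\<^sub>R h) = (\<lambda>\<xi>. complex_of_real r * t h \<xi>)"
      by (intro ext) (simp add: t_def mult_ac)
    then have "infsum (t (r *\<^sub>R h)) UNIV = r *\<^sub>R infsum (t h) UNIV"
      by (simp add: scaleR_conv_of_real infsum_cmult_right')
    then show "?D (r *\<^sub>R h) = r *\<^sub>R ?D h" unfolding t_def .
  next
    fix h :: "real ^ 'a"
    have "cmod (?D h) \<le> (\<Sum>\<^sub>\<infinity>\<xi>. cmod (t h \<xi>))"
      using norm_infsum_bound[OF t_abs] by (simp add: t_def)
    also have "\<dots> \<le> (\<Sum>\<^sub>\<infinity>\<xi>. norm h * (cmod (a \<xi>) * weight \<xi>))"
      by (intro infsum_mono t_abs summable_on_cmult_right s1 t_bound)
    also have "\<dots> = norm h * M1" by (simp add: M1_def infsum_cmult_right')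
    finally show "cmod (?D h) \<le> norm h * M1" .
  qed
  have rem: "cmod (fourier_series a (x + h) - fourier_series a x - ?D h) \<le> (norm h)\<^sup>2 * M2" for h
  proof -
    define r where "r \<xi> = a \<xi> * (character \<xi> (x + h) - character \<xi> x
      - \<i> * complex_of_real (h \<bullet> freq_vec \<xi>) * character \<xi> x)" for \<xi>
    have r_eq: "r = (\<lambda>\<xi>. a \<xi> * character \<xi> (x + h) - a \<xi> * character \<xi> x - t h \<xi>)"
      by (intro ext) (simp add: r_def t_def algebra_simps)
    have "fourier_series a (x + h) - fourier_series a x - ?D h = infsum r UNIV"
      unfolding r_eq fourier_series_def
      using fourier_series_summable[OF a] t_summable
      by (simp add: infsum_diff summable_on_diff) (simp add: t_def[abs_def])
    moreover have r_bound: "cmod (r \<xi>) \<le> (norm h)\<^sup>2 * (cmod (a \<xi>) * (weight \<xi>)\<^sup>2)" for \<xi>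
      using mult_left_mono[OF character_expansion[of \<xi> x h], of "cmod (a \<xi>)"]
      by (simp add: r_def norm_mult mult_ac)
    moreover have r_abs: "(\<lambda>\<xi>. cmod (r \<xi>)) summable_on UNIV"
      by (rule summable_on_comparison_test[OF summable_on_cmult_right[OF s2] r_bound]) auto
    moreover have "cmod (infsum r UNIV) \<le> (\<Sum>\<^sub>\<infinity>\<xi>. (norm h)\<^sup>2 * (cmod (a \<xi>) * (weight \<xi>)\<^sup>2))"
      by (rule order_trans[OF norm_infsum_bound[OF r_abs]])
        (intro infsum_mono r_abs summable_on_cmult_right s2 r_bound)
    ultimately show ?thesis by (simp add: M2_def infsum_cmult_right')
  qed
  show ?thesis
    unfolding has_derivative_at
  proof (intro conjI lin)
    show "(\<lambda>h. norm (fourier_series a (x + h) - fourier_series a x - ?D h) / norm h) \<midarrow>0\<rightarrow> 0"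
    proof (rule tendsto_sandwich[OF _ _ tendsto_const])
      show "\<forall>\<^sub>F h in at 0. norm (fourier_series a (x + h) - fourier_series a x - ?D h) / norm h
              \<le> norm h * M2"
        unfolding eventually_at_filter
        using rem by (auto intro!: always_eventually simp: divide_le_eq power2_eq_square mult_ac)
      have "((\<lambda>h::real^'a. norm h * M2) \<longlongrightarrow> norm (0::real^'a) * M2) (at 0)"
        by (intro tendsto_intros)
      then show "((\<lambda>h::real^'a. norm h * M2) \<longlongrightarrow> 0) (at 0)" by simp
    qed auto
  qed
qed

lemma partial_deriv_fourier_series:
  assumes "rapidly_decreasing a"
  shows "partial_deriv j (fourier_series a) = fourier_series (\<lambda>\<xi>. \<i> * of_int (\<xi> $ j) * a \<xi>)"
proof
  fix x
  have "frechet_derivative (fourier_series a) (at x)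
      = (\<lambda>h. \<Sum>\<^sub>\<infinity>\<xi>. a \<xi> * (\<i> * complex_of_real (h \<bullet> freq_vec \<xi>) * character \<xi> x))"
    using frechet_derivative_at[OF fourier_series_has_derivative[OF assms]] by simp
  then show "partial_deriv j (fourier_series a) x = fourier_series (\<lambda>\<xi>. \<i> * of_int (\<xi> $ j) * a \<xi>) x"
    by (simp add: partial_deriv_def fourier_series_def inner_axis' freq_vec_def mult_ac)
qed

text \<open>The Fourier symbol of the differential operator \<open>iter_partial js\<close>.\<close>

definition deriv_symbol :: "'n list \<Rightarrow> int ^ 'n \<Rightarrow> complex" where
  "deriv_symbol js \<xi> = (\<Prod>j\<leftarrow>js. \<i> * of_int (\<xi> $ j))"

lemma cmod_deriv_symbol_le: "cmod (deriv_symbol js \<xi>) \<le> weight \<xi> ^ length js"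
  by (induction js) (auto simp: deriv_symbol_def norm_mult abs_component_le_weight intro!: mult_mono)

lemma polynomial_growth_deriv_symbol: "polynomial_growth (deriv_symbol js)"
  by (rule polynomial_growthI[of _ 1 "length js"]) (simp add: cmod_deriv_symbol_le)

lemma iter_partial_fourier_series:
  assumes "rapidly_decreasing a"
  shows "iter_partial js (fourier_series a) = fourier_series (\<lambda>\<xi>. deriv_symbol js \<xi> * a \<xi>)"
proof (induction js)
  case Nil
  show ?case by (simp add: iter_partial_def deriv_symbol_def)
next
  case (Cons j js)
  have "iter_partial (j # js) (fourier_series a)
      = partial_deriv j (fourier_series (\<lambda>\<xi>. deriv_symbol js \<xi> * a \<xi>))"
    using Cons by (simp add: iter_partial_def)
  also have "\<dots> = fourier_series (\<lambda>\<xi>. \<i> * of_int (\<xi> $ j) * (deriv_symbol js \<xi> * a \<xi>))"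
    by (intro partial_deriv_fourier_series rapidly_decreasing_mult polynomial_growth_deriv_symbol assms)
  finally show ?case by (simp add: deriv_symbol_def mult.assoc)
qed

lemma fourier_series_test_function:
  assumes "rapidly_decreasing a"
  shows "fourier_series a \<in> test_functions"
proof -
  have "iter_partial js (fourier_series a) differentiable (at x)" for js x
    unfolding iter_partial_fourier_series[OF assms]
    using fourier_series_has_derivative[OF rapidly_decreasing_mult[OF polynomial_growth_deriv_symbol assms]]
    by (auto simp: differentiable_def)
  then show ?thesis
    by (auto simp: test_functions_def smooth_def periodic_def fourier_series_periodic)
qed

lemma character_test_function: "character \<xi> \<in> test_functions"
proof -
  have "fourier_series (\<lambda>\<eta>. if \<eta> = \<xi> then 1 else 0) = character \<xi>"
    by (auto simp: fourier_series_delta)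
  moreover have "rapidly_decreasing (\<lambda>\<eta>. if \<eta> = \<xi> then 1 else 0)"
    by (rule finite_support_rapidly_decreasing) auto
  ultimately show ?thesis
    using fourier_series_test_function by metis
qed

subsection \<open>Integration of periodic functions over a period\<close>

text \<open>Centred at the origin, so that the point where \<open>peak_kernel\<close> has its
  maximum is interior.\<close>

abbreviation period_box :: "(real ^ 'n) set" where
  "period_box \<equiv> cbox (\<chi> j. - pi) (\<chi> j. pi)"

text \<open>The counterpart for functions of \<open>fourier_coeff\<close>, normalised to invert
  \<open>fourier_series\<close>.\<close>

definition torus_coeff :: "(real ^ 'n \<Rightarrow> complex) \<Rightarrow> int ^ 'n \<Rightarrow> complex" where
  "torus_coeff \<phi> \<xi> =
     integral period_box (\<lambda>x. \<phi> x * character (- \<xi>) x) / complex_of_real ((2 * pi) ^ CARD('n))"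

lemma content_period_box: "measure lborel (period_box :: (real ^ 'n) set) = (2 * pi) ^ CARD('n)"
proof -
  have "(0 :: real ^ 'n) \<in> period_box" by (simp add: mem_box_cart)
  then have "(period_box :: (real ^ 'n) set) \<noteq> {}" by blast
  then show ?thesis by (simp add: content_cbox_cart)
qed

lemma integral_periodic_translate_axis_nonneg:
  fixes g :: "real ^ 'n \<Rightarrow> complex"
  assumes g: "continuous_on UNIV g" "periodic g" and "0 \<le> t"
  shows "integral period_box (\<lambda>x. g (x + axis j t)) = integral period_box g"
proof -
  define B :: "real \<Rightarrow> real \<Rightarrow> (real ^ 'n) set"
    where "B a b = cbox (\<chi> i. if i = j then a else - pi) (\<chi> i. if i = j then b else pi)" for a b
  have box: "period_box = B (- pi) pi"
    unfolding B_def by (rule arg_cong2[where f = cbox]) (auto simp: vec_eq_iff)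
  have mem_B: "x \<in> B a b \<longleftrightarrow> a \<le> x $ j \<and> x $ j \<le> b \<and> (\<forall>i. i \<noteq> j \<longrightarrow> - pi \<le> x $ i \<and> x $ i \<le> pi)" for x a b
    unfolding B_def mem_box_cart by auto
  have integrable: "g integrable_on B a b" for a b
    unfolding B_def by (rule integrable_continuous) (rule continuous_on_subset[OF g(1)], simp)
  have split: "integral (B a b) g = integral (B a c) g + integral (B c b) g"
    if "a \<le> c" "c \<le> b" for a b c
  proof -
    have "B a b \<inter> {x. x \<bullet> axis j 1 \<le> c} = B a c" "B a b \<inter> {x. c \<le> x \<bullet> axis j 1} = B c b"
      using that by (auto simp: mem_B inner_axis)
    moreover have "axis j (1::real) \<in> Basis" by (simp add: axis_in_Basis_iff)
    ultimately show ?thesis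
      using integral_split[OF integrable[of a b, unfolded B_def], of "axis j 1" c]
      by (simp add: B_def)
  qed
  have shift: "integral (B a b) (\<lambda>x. g (x + axis j c)) = integral (B (a + c) (b + c)) g" for a b c
  proof -
    have "(\<chi> i. if i = j then a + c else - pi) - axis j c = (\<chi> i. if i = j then a else - pi)"
      "(\<chi> i. if i = j then b + c else pi) - axis j c = (\<chi> i. if i = j then b else pi)"
      by (auto simp: vec_eq_iff axis_def)
    then show ?thesis
      unfolding B_def
      using integral_shift_cbox[of "\<chi> i. if i = j then a + c else - pi" "axis j c"
        "\<chi> i. if i = j then b + c else pi" g] by simp
  qed
  \<comment> \<open>Cut the enlarged box \<open>B (- pi) (pi + t)\<close> at height \<open>pi\<close> and at height \<open>- pi + t\<close>; by periodicity
    the two pieces of height \<open>t\<close> have the same integral.\<close>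
  have "integral period_box (\<lambda>x. g (x + axis j t)) = integral (B (- pi + t) (pi + t)) g"
    unfolding box by (rule shift)
  moreover have "integral (B (- pi) (pi + t)) g = integral (B (- pi) pi) g + integral (B pi (pi + t)) g"
    "integral (B (- pi) (pi + t)) g = integral (B (- pi) (- pi + t)) g + integral (B (- pi + t) (pi + t)) g"
    using \<open>0 \<le> t\<close> by (auto intro!: split)
  moreover have "integral (B pi (pi + t)) g = integral (B (- pi) (- pi + t)) g"
  proof -
    have "(\<lambda>x. g (x + axis j (2 * pi))) = g" using g(2) by (simp add: periodic_def)
    moreover have "- pi + 2 * pi = pi" "- pi + t + 2 * pi = pi + t" by simp_all
    ultimately show ?thesis
      using shift[of "- pi" "- pi + t" "2 * pi"] by metis
  qed
  ultimately show ?thesis by (simp add: box)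
qed

lemma periodic_translate: "periodic g \<Longrightarrow> periodic (\<lambda>x. g (x + v))"
  unfolding periodic_def by (simp add: add.assoc add.commute[of _ v]) (simp flip: add.assoc)

lemma continuous_on_translate:
  "continuous_on UNIV g \<Longrightarrow> continuous_on UNIV (\<lambda>x. g (x + v))" for v :: "'a::real_normed_vector"
  by (rule continuous_on_compose2[of UNIV g]) (auto intro!: continuous_intros)

text \<open>A negative shift is undone by a nonnegative one: the previous lemma, with the shift
  \<open>- t\<close>, is applied to the translated function.\<close>

lemma integral_periodic_translate_axis:
  fixes g :: "real ^ 'n \<Rightarrow> complex"
  assumes g: "continuous_on UNIV g" "periodic g"
  shows "integral period_box (\<lambda>x. g (x + axis j t)) = integral period_box g"
proof (cases "0 \<le> t")
  case True
  then show ?thesis using integral_periodic_translate_axis_nonneg[OF g] by blast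
next
  case False
  have "axis j (- t) + axis j t = 0" by (simp add: axis_def vec_eq_iff)
  then have "x + axis j (- t) + axis j t = x" for x :: "real ^ 'n"
    by (simp add: add.assoc)
  then show ?thesis
    using False integral_periodic_translate_axis_nonneg
      [OF continuous_on_translate[OF g(1)] periodic_translate[OF g(2)], of "- t" j "axis j t"]
    by (simp add: add.assoc)
qed

lemma sum_axis: "(\<Sum>j\<in>UNIV. axis j (v $ j)) = (v :: real ^ 'n)"
  by (simp add: vec_eq_iff axis_def if_distrib cong: if_cong)

lemma integral_periodic_translate:
  fixes g :: "real ^ 'n \<Rightarrow> complex"
  assumes g: "continuous_on UNIV g" "periodic g"
  shows "integral period_box (\<lambda>x. g (x + v)) = integral period_box g"
proof -
  have "integral period_box (\<lambda>x. g (x + (\<Sum>j\<in>J. axis j (v $ j)))) = integral period_box g"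
    if "finite J" for J
    using that
  proof (induction J rule: finite_induct)
    case (insert j J)
    let ?s = "\<Sum>j\<in>J. axis j (v $ j)"
    have "x + (\<Sum>j\<in>insert j J. axis j (v $ j)) = x + axis j (v $ j) + ?s" for x
      using insert by (simp add: add.assoc)
    then have "integral period_box (\<lambda>x. g (x + (\<Sum>j\<in>insert j J. axis j (v $ j))))
        = integral period_box (\<lambda>x. g (x + axis j (v $ j) + ?s))"
      by (simp only:)
    also have "\<dots> = integral period_box (\<lambda>x. g (x + ?s))"
      by (rule integral_periodic_translate_axis)
        (intro continuous_on_translate periodic_translate g)+
    finally show ?case using insert.IH by (simp only:)
  qed simp
  from this[of UNIV] show ?thesis
    by (simp add: sum_axis)
qed

section \<open>Differentiation along the axes and coefficients of derivatives\<close>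

lemma axis_eq_scaleR: "axis j t = t *\<^sub>R axis j (1::real)"
  by (simp add: axis_def vec_eq_iff)

lemma continuous_on_axis [continuous_intros]:
  "continuous_on S f \<Longrightarrow> continuous_on S (\<lambda>x. axis j (f x :: real))"
  by (subst axis_eq_scaleR) (intro continuous_intros)

text \<open>The integral of the translate by \<open>axis j t\<close> does not depend on
  \<open>t\<close>; differentiating it under the integral sign at \<open>t = 0\<close> gives the
  claim. This replaces the boundary terms of an integration by parts.\<close>

lemma integral_periodic_derivative:
  fixes g g' :: "real ^ 'n \<Rightarrow> complex"
  assumes g: "continuous_on UNIV g" "periodic g" and g': "continuous_on UNIV g'"
    and deriv: "\<And>x t. ((\<lambda>t. g (x + axis j t)) has_vector_derivative g' (x + axis j t)) (at t)"
  shows "integral period_box g' = 0"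
proof -
  have "((\<lambda>t. integral period_box (\<lambda>x. g (x + axis j t))) has_vector_derivative
      integral period_box (\<lambda>x. g' (x + axis j 0))) (at 0 within UNIV)"
  proof (rule leibniz_rule_vector_derivative[where f = "\<lambda>t x. g (x + axis j t)"
        and fx = "\<lambda>t x. g' (x + axis j t)"])
    show "(\<lambda>x. g (x + axis j t)) integrable_on period_box" for t
      by (rule integrable_continuous)
        (rule continuous_on_subset[OF continuous_on_translate[OF g(1)]], simp)
    show "continuous_on (UNIV \<times> period_box) (\<lambda>(t, x). g' (x + axis j t))"
      unfolding split_beta
      by (rule continuous_on_compose2[OF g']) (auto intro!: continuous_intros)
  qed (use deriv in auto)
  then have "((\<lambda>t::real. integral period_box g) has_vector_derivative integral period_box g') (at 0)"
    by (simp add: integral_periodic_translate_axis[OF g] axis_eq_scaleR[of j 0])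
  then show ?thesis
    using vector_derivative_unique_at[OF _ has_vector_derivative_const] by metis
qed

lemma has_vector_derivative_along_axis:
  assumes "f differentiable (at (x + axis j t))"
  shows "((\<lambda>t. f (x + axis j t)) has_vector_derivative partial_deriv j f (x + axis j t)) (at t)"
proof -
  have f: "(f has_derivative frechet_derivative f (at (x + axis j t))) (at (x + axis j t))"
    using assms frechet_derivative_works by blast
  have "((\<lambda>t. x + t *\<^sub>R axis j 1) has_derivative (\<lambda>h. h *\<^sub>R axis j 1)) (at t)"
    by (auto intro!: derivative_eq_intros)
  from has_derivative_compose[OF this] f
  have "((\<lambda>t. f (x + axis j t)) has_derivative
      (\<lambda>h. frechet_derivative f (at (x + axis j t)) (h *\<^sub>R axis j 1))) (at t)"
    by (simp flip: axis_eq_scaleR)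
  moreover have "frechet_derivative f (at (x + axis j t)) (h *\<^sub>R axis j 1)
      = h *\<^sub>R frechet_derivative f (at (x + axis j t)) (axis j 1)" for h
    using has_derivative_bounded_linear[OF f] by (simp add: bounded_linear.linear linear_cmul)
  ultimately show ?thesis
    by (simp add: has_vector_derivative_def partial_deriv_def)
qed

lemma partial_deriv_character:
  "partial_deriv j (character \<xi>) x = \<i> * of_int (\<xi> $ j) * character \<xi> x"
proof -
  define d where "d = (\<lambda>\<eta>. if \<eta> = \<xi> then 1 else 0 :: complex)"
  have d: "rapidly_decreasing d"
    by (rule finite_support_rapidly_decreasing) (auto simp: d_def)
  have "character \<xi> = fourier_series d"
    by (auto simp: fourier_series_delta d_def)
  then have "partial_deriv j (character \<xi>) x
      = fourier_series (\<lambda>\<eta>. if \<eta> = \<xi> then \<i> * of_int (\<xi> $ j) else 0) x"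
    by (simp add: partial_deriv_fourier_series[OF d]) (simp add: d_def if_distrib cong: if_cong)
  then show ?thesis by (simp add: fourier_series_delta)
qed

lemma test_function_differentiable: "\<phi> \<in> test_functions \<Longrightarrow> \<phi> differentiable (at x)"
  by (auto simp: test_functions_def smooth_def iter_partial_def dest: spec[of _ "[]"])

lemma test_function_continuous: "\<phi> \<in> test_functions \<Longrightarrow> continuous_on S \<phi>"
  using test_function_differentiable
  by (meson continuous_at_imp_continuous_on differentiable_imp_continuous_within)

lemma test_function_periodic: "\<phi> \<in> test_functions \<Longrightarrow> periodic \<phi>"
  by (simp add: test_functions_def)

lemma partial_deriv_test_function:
  assumes "\<phi> \<in> test_functions"
  shows "partial_deriv j \<phi> \<in> test_functions"
proof -
  \<comment> \<open>\<open>foldr\<close> applies the last direction first.\<close>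
  have "iter_partial js (partial_deriv j \<phi>) = iter_partial (js @ [j]) \<phi>" for js
    by (simp add: iter_partial_def)
  then have "smooth (partial_deriv j \<phi>)"
    using assms by (simp add: test_functions_def smooth_def)
  moreover have "periodic (partial_deriv j \<phi>)"
    unfolding periodic_def
  proof (intro allI)
    fix i :: 'a and x :: "real ^ 'a"
    let ?v = "axis i (2 * pi)"
    have "(\<phi> has_derivative frechet_derivative \<phi> (at (x + ?v))) (at (x + ?v))"
      using test_function_differentiable[OF assms] frechet_derivative_works by blast
    moreover have "((\<lambda>y. y + ?v) has_derivative (\<lambda>h. h)) (at x)"
      by (auto intro!: derivative_eq_intros)
    ultimately have "((\<lambda>y. \<phi> (y + ?v)) has_derivative frechet_derivative \<phi> (at (x + ?v))) (at x)"
      using has_derivative_compose[of "\<lambda>y. y + ?v" "\<lambda>h. h" x UNIV \<phi>] by simp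
    moreover have "(\<lambda>y. \<phi> (y + ?v)) = \<phi>"
      using test_function_periodic[OF assms] by (auto simp: periodic_def)
    ultimately have "frechet_derivative \<phi> (at x) = frechet_derivative \<phi> (at (x + ?v))"
      using frechet_derivative_at by metis
    then show "partial_deriv j \<phi> (x + ?v) = partial_deriv j \<phi> x"
      by (simp add: partial_deriv_def)
  qed
  ultimately show ?thesis by (simp add: test_functions_def)
qed

lemma iter_partial_test_function:
  "\<phi> \<in> test_functions \<Longrightarrow> iter_partial js \<phi> \<in> test_functions"
  by (induction js) (auto simp: iter_partial_def partial_deriv_test_function)

text \<open>Integration by parts: \<open>?g'\<close> is the derivative along the axis of the
  periodic product of \<phi> and \<open>character (- \<xi>)\<close>, so its integral
  vanishes.\<close>

lemma torus_coeff_partial_deriv: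
  assumes "\<phi> \<in> test_functions"
  shows "torus_coeff (partial_deriv j \<phi>) \<xi> = \<i> * of_int (\<xi> $ j) * torus_coeff \<phi> \<xi>"
proof -
  let ?c = "character (- \<xi>)"
  let ?g' = "\<lambda>x. partial_deriv j \<phi> x * ?c x - \<i> * of_int (\<xi> $ j) * (\<phi> x * ?c x)"
  note cont = test_function_continuous[OF assms]
    test_function_continuous[OF partial_deriv_test_function[OF assms]]
  have "integral period_box ?g' = 0"
  proof (rule integral_periodic_derivative[where g = "\<lambda>x. \<phi> x * ?c x" and j = j])
    show "periodic (\<lambda>x. \<phi> x * ?c x)"
      using test_function_periodic[OF assms] by (simp add: periodic_def character_periodic)
    fix x t
    show "((\<lambda>t. \<phi> (x + axis j t) * ?c (x + axis j t)) has_vector_derivative ?g' (x + axis j t)) (at t)"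
      by (rule has_vector_derivative_eq_rhs,
          rule has_vector_derivative_mult[OF
            has_vector_derivative_along_axis[OF test_function_differentiable[OF assms]]
            has_vector_derivative_along_axis[OF test_function_differentiable[OF character_test_function]]])
        (simp add: partial_deriv_character algebra_simps)
  qed (intro continuous_intros cont)+
  moreover have "integral period_box ?g' = integral period_box (\<lambda>x. partial_deriv j \<phi> x * ?c x)
      - \<i> * of_int (\<xi> $ j) * integral period_box (\<lambda>x. \<phi> x * ?c x)"
    by (subst integral_diff) (auto intro!: integrable_continuous continuous_intros cont)
  ultimately show ?thesis by (simp add: torus_coeff_def)
qed

lemma cmod_torus_coeff_le:
  fixes \<phi> :: "real ^ 'n \<Rightarrow> complex"
  assumes "continuous_on UNIV \<phi>" and bound: "\<And>x. x \<in> period_box \<Longrightarrow> cmod (\<phi> x) \<le> B"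
  shows "cmod (torus_coeff \<phi> \<xi>) \<le> B"
proof -
  have "(0 :: real ^ 'n) \<in> period_box" by (simp add: mem_box_cart)
  then have "0 \<le> B" using bound norm_ge_zero order_trans by blast
  have "continuous_on period_box \<phi>" using assms(1) continuous_on_subset by blast
  then have "(\<lambda>x. \<phi> x * character (- \<xi>) x) integrable_on period_box"
    by (intro integrable_continuous continuous_intros)
  then have "cmod (integral period_box (\<lambda>x. \<phi> x * character (- \<xi>) x))
      \<le> B * measure lborel (period_box :: (real ^ 'n) set)"
    by (intro has_integral_bound[OF \<open>0 \<le> B\<close> integrable_integral]) (auto simp: norm_mult bound)
  then show ?thesis
    by (simp add: torus_coeff_def content_period_box norm_divide norm_power norm_mult divide_le_eq)
qed

text \<open>No integral is computed for nonzero \<xi>: the constant function 1 has derivative 0, so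
  the rule for coefficients of derivatives gives 0 as a nonzero multiple of its coefficient at -
  \<xi>, and this coefficient is the integral up to normalisation.\<close>

lemma integral_character:
  "integral period_box (character \<xi> :: real ^ 'n \<Rightarrow> complex)
     = (if \<xi> = 0 then complex_of_real ((2 * pi) ^ CARD('n)) else 0)"
proof (cases "\<xi> = 0")
  case True
  have "integral (period_box :: (real ^ 'n) set) (\<lambda>x. 1 :: complex) = of_real ((2 * pi) ^ CARD('n))"
    by (simp add: content_period_box scaleR_conv_of_real)
  moreover have "character 0 = (\<lambda>x :: real ^ 'n. 1)" by auto
  ultimately show ?thesis using True by simp
next
  case False
  then obtain j where j: "\<xi> $ j \<noteq> 0" by (auto simp: vec_eq_iff)
  have "torus_coeff (\<lambda>x :: real ^ 'n. 1) (- \<xi>) = 0"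
  proof -
    have "torus_coeff (partial_deriv j (character 0)) (- \<xi>)
        = \<i> * of_int ((- \<xi>) $ j) * torus_coeff (character 0) (- \<xi>)"
      by (rule torus_coeff_partial_deriv[OF character_test_function])
    moreover have "torus_coeff (partial_deriv j (character 0)) (- \<xi>) = 0"
      by (simp add: torus_coeff_def partial_deriv_character)
    moreover have "character 0 = (\<lambda>x :: real ^ 'n. 1)" by auto
    ultimately show ?thesis using j by simp
  qed
  then show ?thesis using False by (simp add: torus_coeff_def)
qed

text \<open>The M-test makes the finite partial sums converge uniformly, so the integrals converge
  too; by orthogonality the integral over a partial sum is constant as soon as the index set
  contains \<eta>.\<close>

lemma torus_coeff_fourier_series:
  fixes a :: "int ^ 'n \<Rightarrow> complex"
  assumes a: "rapidly_decreasing a"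
  shows "torus_coeff (fourier_series a) \<eta> = a \<eta>"
proof -
  define f where "f A x = (\<Sum>\<xi>\<in>A. a \<xi> * character (\<xi> - \<eta>) x)" for A and x :: "real ^ 'n"
  define V where "V = complex_of_real ((2 * pi) ^ CARD('n))"
  have "V \<noteq> 0" by (simp add: V_def)
  have series: "fourier_series a x * character (- \<eta>) x = (\<Sum>\<^sub>\<infinity>\<xi>. a \<xi> * character (\<xi> - \<eta>) x)" for x
    unfolding fourier_series_def infsum_cmult_left'[symmetric]
    by (simp add: mult.assoc character_mult)
  have "uniform_limit period_box f (\<lambda>x. fourier_series a x * character (- \<eta>) x)
      (finite_subsets_at_top UNIV)"
    unfolding series f_def
    by (rule Weierstrass_m_test_general[where M = "\<lambda>\<xi>. cmod (a \<xi>)"])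
      (auto simp: norm_mult rapidly_decreasing_summable[OF a])
  moreover have "continuous_on period_box (f A)" for A
    unfolding f_def by (intro continuous_intros)
  ultimately obtain I J where I: "\<And>A. (f A has_integral I A) period_box"
    and J: "((\<lambda>x. fourier_series a x * character (- \<eta>) x) has_integral J) period_box"
    and lim: "(I \<longlongrightarrow> J) (finite_subsets_at_top UNIV)"
    by (rule uniform_limit_integral_cbox) auto
  have "I A = a \<eta> * V" if "finite A" "\<eta> \<in> A" for A
  proof -
    have "I A = integral period_box (f A)" by (rule integral_unique[OF I, symmetric])
    also have "\<dots> = (\<Sum>\<xi>\<in>A. integral period_box (\<lambda>x. a \<xi> * character (\<xi> - \<eta>) x))"
      unfolding f_def by (rule integral_sum) (auto intro!: integrable_continuous continuous_intros that)
    also have "\<dots> = (\<Sum>\<xi>\<in>A. if \<xi> = \<eta> then a \<eta> * V else 0)"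
      by (rule sum.cong) (auto simp: integral_character V_def)
    also have "\<dots> = a \<eta> * V" using that by simp
    finally show ?thesis .
  qed
  then have "\<forall>\<^sub>F A in finite_subsets_at_top UNIV. I A = a \<eta> * V"
    unfolding eventually_finite_subsets_at_top by (intro exI[of _ "{\<eta>}"]) auto
  then have "(I \<longlongrightarrow> a \<eta> * V) (finite_subsets_at_top UNIV)"
    by (rule tendsto_eventually)
  then have "J = a \<eta> * V"
    using lim tendsto_unique finite_subsets_at_top_neq_bot by blast
  then show ?thesis
    using J \<open>V \<noteq> 0\<close> by (simp add: torus_coeff_def integral_unique V_def)
qed

subsection \<open>Completeness of the characters and Fourier inversion\<close>

text \<open>Each factor is the square of \<open>cos (x $ j / 2)\<close>; up to normalisation the
  powers are products of de la Vallee Poussin kernels. The kernel is a trigonometric polynomial with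
  values between 0 and 1 that takes the value 1 in \<open>period_box\<close> only at the
  origin.\<close>

definition peak_kernel :: "real ^ 'n \<Rightarrow> real" where
  "peak_kernel x = (\<Prod>j\<in>UNIV. (1 + cos (x $ j)) / 2)"

lemma continuous_on_peak_kernel [continuous_intros]: "continuous_on S peak_kernel"
  unfolding peak_kernel_def by (intro continuous_intros) auto

lemma half_one_plus_cos: "0 \<le> (1 + cos t) / (2::real)" "(1 + cos t) / 2 \<le> (1::real)"
  using cos_ge_minus_one[of t] cos_le_one[of t] by (simp_all, linarith)

lemma peak_kernel_nonneg: "0 \<le> peak_kernel x"
  unfolding peak_kernel_def by (intro prod_nonneg half_one_plus_cos)

lemma peak_kernel_0: "peak_kernel 0 = 1"
  by (simp add: peak_kernel_def)

lemma peak_kernel_less_1: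
  assumes "x \<in> period_box" "x \<noteq> 0"
  shows "peak_kernel x < 1"
proof -
  obtain j where "x $ j \<noteq> 0" using assms(2) by (auto simp: vec_eq_iff)
  moreover have "\<bar>x $ j\<bar> \<le> pi" using assms(1) by (auto simp: mem_box_cart abs_le_iff minus_le_iff)
  ultimately have "cos \<bar>x $ j\<bar> < cos 0"
    by (intro cos_monotone_0_pi) auto
  then have "(1 + cos (x $ j)) / 2 < 1" by simp
  moreover have "peak_kernel x = (1 + cos (x $ j)) / 2 * (\<Prod>i\<in>UNIV - {j}. (1 + cos (x $ i)) / 2)"
    unfolding peak_kernel_def by (rule prod.remove) auto
  moreover have "(\<Prod>i\<in>UNIV - {j}. (1 + cos (x $ i)) / 2) \<le> 1"
    by (intro prod_le_1 conjI half_one_plus_cos)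
  ultimately show ?thesis
    by (metis half_one_plus_cos(1) le_less_trans mult_left_le)
qed

text \<open>High powers of the kernel concentrate at the origin, where \<open>f\<close> is close to
  1. The contribution of a small box there decays at most like \<open>q' ^ N\<close>, and that of
  the points far from 0 at least as fast as \<open>q ^ N\<close> with \<open>q < q'\<close>, so the
  integral cannot vanish for all \<open>N\<close>.\<close>

lemma peak_kernel_concentration:
  fixes f :: "real ^ 'n \<Rightarrow> real"
  assumes f: "continuous_on UNIV f" "f 0 = 1"
    and zero: "\<And>N. ((\<lambda>x. f x * peak_kernel x ^ N) has_integral 0) period_box"
  shows False
proof -
  let ?P = "period_box :: (real ^ 'n) set"
  obtain \<delta> where \<delta>: "\<delta> > 0" "\<And>x. norm x < \<delta> \<Longrightarrow> 1 / 2 < f x"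
  proof -
    have "isCont f 0" using f(1) by (simp add: continuous_on_eq_continuous_at)
    then obtain d where "d > 0" "\<forall>x. dist x 0 < d \<longrightarrow> dist (f x) (f 0) < 1 / 2"
      unfolding continuous_at_eps_delta by (metis half_gt_zero zero_less_one)
    show ?thesis
    proof (rule that[OF \<open>0 < d\<close>])
      fix x :: "real ^ 'n"
      assume "norm x < d"
      then have "\<bar>f x - 1\<bar> < 1 / 2"
        using \<open>\<forall>x. dist x 0 < d \<longrightarrow> dist (f x) (f 0) < 1 / 2\<close> f(2)
        by (metis dist_0_norm dist_commute dist_real_def)
      then show "1 / 2 < f x" by linarith
    qed
  qed
  obtain M where M: "0 < M" "\<And>x. x \<in> ?P \<Longrightarrow> \<bar>f x\<bar> \<le> M"
  proof -
    have "compact (f ` ?P)"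
      using f(1) by (intro compact_continuous_image) (auto intro: continuous_on_subset)
    then obtain M where "0 < M" "\<forall>y\<in>f ` ?P. norm y \<le> M"
      using compact_imp_bounded bounded_pos by blast
    then show ?thesis using that by auto
  qed
  \<comment> \<open>By compactness the kernel stays away from 1 outside the ball; if the ball covers
    the whole period box, \<open>q = 0\<close> serves vacuously.\<close>
  obtain q where q: "0 \<le> q" "q < 1" "\<And>x. x \<in> ?P \<Longrightarrow> \<delta> \<le> norm x \<Longrightarrow> peak_kernel x \<le> q"
  proof (cases "?P - ball 0 \<delta> = {}")
    case True
    then show ?thesis using that[of 0] by (force simp: ball_def)
  next
    case False
    have "compact (?P - ball 0 \<delta>)" by (intro compact_diff) auto
    from continuous_attains_sup[OF this False continuous_on_peak_kernel]
    obtain y where y: "y \<in> ?P - ball 0 \<delta>" "\<And>x. x \<in> ?P - ball 0 \<delta> \<Longrightarrow> peak_kernel x \<le> peak_kernel y"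
      by blast
    then have "y \<noteq> 0" using \<delta>(1) by auto
    then show ?thesis
      using that[of "peak_kernel y"] y peak_kernel_less_1 peak_kernel_nonneg by (auto simp: ball_def)
  qed
  \<comment> \<open>Strictly between \<open>q\<close> and the peak value 1, so that the kernel still
    exceeds \<open>q'\<close> on a neighbourhood of the origin.\<close>
  define q' where "q' = (1 + q) / 2"
  have q': "q < q'" "q' < 1" using q by (auto simp: q'_def)
  define U :: "(real ^ 'n) set"
    where "U = {x. q' < peak_kernel x} \<inter> ball 0 \<delta> \<inter> box (\<chi> j. - pi) (\<chi> j. pi)"
  have "open {x. q' < peak_kernel (x :: real ^ 'n)}"
    by (intro open_Collect_less continuous_on_peak_kernel continuous_on_const)
  then have "open U" unfolding U_def by (intro open_Int) auto
  moreover have "0 \<in> U" using \<delta>(1) q' by (simp add: U_def peak_kernel_0 mem_box_cart)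
  ultimately obtain a b where ab: "0 \<in> box a b" "cbox a b \<subseteq> U"
    by (rule open_contains_cbox)
  define V where "V = measure lborel (cbox a b)"
  define W where "W = measure lborel ?P"
  have "0 < V"
    unfolding V_def using ab(1) by (intro content_pos_lt) (auto simp: mem_box intro: less_trans)
  have "0 < W" by (simp add: W_def content_period_box)
  have sub: "cbox a b \<subseteq> ?P" using ab(2) by (auto simp: U_def intro: subsetD[OF box_subset_cbox])
  \<comment> \<open>The integrand is minorised by \<open>q' ^ N / 2\<close> on the small box minus
    \<open>M * q ^ N\<close> everywhere: inside the ball \<open>f\<close> exceeds 1/2 and the
    product is nonnegative, outside it the absolute value is at most
    \<open>M * q ^ N\<close>.\<close>
  have ineq: "q' ^ N * V / 2 \<le> M * q ^ N * W" for N
  proof -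
    have "((\<lambda>x. if x \<in> cbox a b then q' ^ N / 2 else 0) has_integral V * (q' ^ N / 2)) ?P"
      unfolding has_integral_restrict[OF sub] V_def using has_integral_const[of "q' ^ N / 2" a b] by simp
    moreover have "((\<lambda>x. M * q ^ N) has_integral W * (M * q ^ N)) ?P"
      unfolding W_def using has_integral_const[of "M * q ^ N"] by fastforce
    ultimately have "((\<lambda>x. (if x \<in> cbox a b then q' ^ N / 2 else 0) - M * q ^ N)
        has_integral V * (q' ^ N / 2) - W * (M * q ^ N)) ?P"
      by (rule has_integral_diff)
    then have "V * (q' ^ N / 2) - W * (M * q ^ N) \<le> 0"
    proof (rule has_integral_le[OF _ zero[of N]])
      fix x assume x: "x \<in> ?P"
      have nonneg: "0 \<le> M * q ^ N" using M q by simp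
      show "(if x \<in> cbox a b then q' ^ N / 2 else 0) - M * q ^ N \<le> f x * peak_kernel x ^ N"
      proof (cases "norm x < \<delta>")
        case True
        then have half: "1 / 2 * peak_kernel x ^ N \<le> f x * peak_kernel x ^ N"
          using \<delta>(2)[of x] peak_kernel_nonneg[of x] by (intro mult_right_mono) auto
        have "q' ^ N \<le> peak_kernel x ^ N" if "x \<in> cbox a b"
          using that ab(2) q q' by (intro power_mono) (auto simp: U_def)
        moreover have "0 \<le> peak_kernel x ^ N" by (simp add: peak_kernel_nonneg)
        ultimately show ?thesis using half nonneg by auto
      next
        case False
        then have "x \<notin> cbox a b" using ab(2) by (auto simp: U_def)
        have "peak_kernel x ^ N \<le> q ^ N"
          using False q x by (intro power_mono peak_kernel_nonneg) auto
        then have "\<bar>f x * peak_kernel x ^ N\<bar> \<le> M * q ^ N"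
          using M x by (auto simp: abs_mult peak_kernel_nonneg intro!: mult_mono)
        then show ?thesis using \<open>x \<notin> cbox a b\<close> by auto
      qed
    qed
    then show ?thesis by (simp add: mult_ac)
  qed
  have "q / q' < 1" using q q' by simp
  moreover have "0 < V / (2 * M * W)" using \<open>0 < V\<close> \<open>0 < W\<close> M by simp
  ultimately obtain N where "(q / q') ^ N < V / (2 * M * W)"
    using real_arch_pow_inv by blast
  then have "M * q ^ N * W < q' ^ N * V / 2"
    using q q' M \<open>0 < W\<close> by (simp add: power_divide field_simps)
  then show False using ineq[of N] by simp
qed

lemma peak_kernel_orthogonal:
  fixes \<psi> :: "real ^ 'n \<Rightarrow> complex"
  assumes \<psi>: "continuous_on UNIV \<psi>" and zero: "\<And>\<xi>. torus_coeff \<psi> \<xi> = 0"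
  shows "((\<lambda>x. \<psi> x * complex_of_real (peak_kernel x ^ N)) has_integral 0) period_box"
proof -
  define Z where "Z h \<longleftrightarrow> continuous_on UNIV h \<and>
    (\<forall>\<xi>. ((\<lambda>x. \<psi> x * h x * character \<xi> x) has_integral 0) (period_box :: (real ^ 'n) set))" for h
  \<comment> \<open>\<open>(1 + cos (x $ j)) / 2\<close> is a combination of the characters of the frequencies \<open>0\<close> and
    \<open>\<plusminus>axis j 1\<close>, so multiplication by it only shifts \<open>\<xi>\<close>.\<close>
  have step: "Z (\<lambda>x. complex_of_real ((1 + cos (x $ j)) / 2) * h x)" if h: "Z h" for h j
    unfolding Z_def
  proof (intro conjI allI)
    show "continuous_on UNIV (\<lambda>x. complex_of_real ((1 + cos (x $ j)) / 2) * h x)"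
      using h by (auto simp: Z_def intro!: continuous_intros)
    fix \<xi>
    have "((\<lambda>x. \<psi> x * h x * character \<xi> x * (1 / 2) + \<psi> x * h x * character (\<xi> + axis j 1) x * (1 / 4)
        + \<psi> x * h x * character (\<xi> + axis j (- 1)) x * (1 / 4)) has_integral 0 * (1 / 2) + 0 * (1 / 4) + 0 * (1 / 4))
        (period_box :: (real ^ 'n) set)"
      using h unfolding Z_def by (intro has_integral_add has_integral_mult_left) auto
    moreover have "complex_of_real ((1 + cos (x $ j)) / 2)
        = 1 / 2 + character (axis j 1) x / 4 + character (axis j (- 1)) x / 4" for x :: "real ^ 'n"
      by (simp add: character_axis_freq cos_exp_eq add_divide_distrib flip: cos_of_real)
    then have "\<psi> x * (complex_of_real ((1 + cos (x $ j)) / 2) * h x) * character \<xi> x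
        = \<psi> x * h x * character \<xi> x * (1 / 2) + \<psi> x * h x * character (\<xi> + axis j 1) x * (1 / 4)
        + \<psi> x * h x * character (\<xi> + axis j (- 1)) x * (1 / 4)" for x
      by (simp only: flip: character_mult) (simp add: algebra_simps)
    ultimately show "((\<lambda>x. \<psi> x * (complex_of_real ((1 + cos (x $ j)) / 2) * h x) * character \<xi> x)
        has_integral 0) period_box"
      by (simp only:) simp
  qed
  have "Z (\<lambda>x. complex_of_real (\<Prod>j\<in>J. (1 + cos (x $ j)) / 2) * h x)" if "finite J" "Z h" for J h
    using that
  proof (induction J rule: finite_induct)
    case (insert j J)
    from step[OF insert.IH[OF insert.prems], of j] insert.hyps show ?case
      by (simp add: mult.assoc)
  qed simp
  from this[of UNIV] have kernel: "Z (\<lambda>x. complex_of_real (peak_kernel x) * h x)" if "Z h" for h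
    using that by (simp add: peak_kernel_def)
  have "Z (\<lambda>x. complex_of_real (peak_kernel x ^ N))"
  proof (induction N)
    case 0
    have "((\<lambda>x. \<psi> x * character \<xi> x) has_integral 0) (period_box :: (real ^ 'n) set)" for \<xi>
    proof -
      have "continuous_on period_box \<psi>" using \<psi> continuous_on_subset by blast
      then have "(\<lambda>x. \<psi> x * character \<xi> x) integrable_on period_box"
        by (intro integrable_continuous continuous_intros)
      then show ?thesis
        using zero[of "- \<xi>"] by (simp add: torus_coeff_def has_integral_iff)
    qed
    then show ?case by (simp add: Z_def)
  next
    case (Suc N)
    from kernel[OF this] show ?case by simp
  qed
  then have "((\<lambda>x. \<psi> x * complex_of_real (peak_kernel x ^ N) * character 0 x) has_integral 0) period_box"
    unfolding Z_def by blast
  then show ?thesis by simp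
qed

text \<open>Allows an arbitrary point to be moved to the origin, the peak of the kernel, without
  losing the vanishing of the coefficients.\<close>

lemma torus_coeff_translate:
  fixes \<psi> :: "real ^ 'n \<Rightarrow> complex"
  assumes "continuous_on UNIV \<psi>" "periodic \<psi>"
  shows "torus_coeff (\<lambda>x. \<psi> (x + v)) \<xi> = character \<xi> v * torus_coeff \<psi> \<xi>"
proof -
  let ?g = "\<lambda>x. \<psi> x * character (- \<xi>) x"
  have "character \<xi> v * character (- \<xi>) v = 1"
    by (simp add: character_mult)
  then have "\<psi> (x + v) * character (- \<xi>) x = character \<xi> v * ?g (x + v)" for x
    by (simp add: character_add mult_ac)
  moreover have "integral period_box (\<lambda>x. ?g (x + v)) = integral period_box ?g"
    using assms
    by (intro integral_periodic_translate continuous_intros) (auto simp: periodic_def character_periodic)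
  ultimately show ?thesis
    by (simp only: torus_coeff_def integral_mult_right) simp
qed

text \<open>Translating \<open>v\<close> to the origin, dividing by \<open>\<psi> v\<close> and
  taking real parts gives a continuous real function with value 1 at 0 whose integrals against all
  powers of the kernel vanish, contrary to \<open>peak_kernel_concentration\<close>.\<close>

lemma torus_coeff_eq_0_imp_eq_0:
  fixes \<psi> :: "real ^ 'n \<Rightarrow> complex"
  assumes \<psi>: "continuous_on UNIV \<psi>" "periodic \<psi>" and zero: "\<And>\<xi>. torus_coeff \<psi> \<xi> = 0"
  shows "\<psi> v = 0"
proof (rule ccontr)
  assume v: "\<psi> v \<noteq> 0"
  let ?\<psi> = "\<lambda>x. \<psi> (x + v)"
  have cont: "continuous_on UNIV ?\<psi>"
    by (rule continuous_on_translate[OF \<psi>(1)])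
  have "((\<lambda>x. Re (?\<psi> x / \<psi> v) * peak_kernel x ^ N) has_integral 0) period_box" for N
  proof -
    have "((\<lambda>x. ?\<psi> x * complex_of_real (peak_kernel x ^ N)) has_integral 0) period_box"
      by (rule peak_kernel_orthogonal[OF cont]) (simp add: torus_coeff_translate \<psi> zero)
    then have "((\<lambda>x. ?\<psi> x * complex_of_real (peak_kernel x ^ N) * (1 / \<psi> v)) has_integral 0 * (1 / \<psi> v)) period_box"
      by (rule has_integral_mult_left)
    from has_integral_linear[OF this bounded_linear_Re]
    have "((\<lambda>x. Re (?\<psi> x * complex_of_real (peak_kernel x ^ N) * (1 / \<psi> v))) has_integral 0) period_box"
      by (simp add: o_def)
    moreover have "Re (?\<psi> x * complex_of_real (peak_kernel x ^ N) * (1 / \<psi> v))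
        = Re (?\<psi> x / \<psi> v) * peak_kernel x ^ N" for x
    proof -
      have "?\<psi> x * complex_of_real (peak_kernel x ^ N) * (1 / \<psi> v)
          = ?\<psi> x / \<psi> v * complex_of_real (peak_kernel x ^ N)" by simp
      then show ?thesis by (simp only: Re_complex_of_real Im_complex_of_real times_complex.sel)
    qed
    ultimately show ?thesis by simp
  qed
  then show False
    using v by (intro peak_kernel_concentration[of "\<lambda>x. Re (?\<psi> x / \<psi> v)"])
      (auto intro!: continuous_intros cont)
qed

section \<open>Decay of the coefficients of test functions, and Fourier inversion\<close>

lemma torus_coeff_iter_partial:
  assumes "\<phi> \<in> test_functions"
  shows "torus_coeff (iter_partial js \<phi>) \<xi> = deriv_symbol js \<xi> * torus_coeff \<phi> \<xi>"
proof (induction js)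
  case (Cons j js)
  have "iter_partial (j # js) \<phi> = partial_deriv j (iter_partial js \<phi>)"
    by (simp add: iter_partial_def)
  then show ?case
    using Cons torus_coeff_partial_deriv[OF iter_partial_test_function[OF assms]]
    by (simp add: deriv_symbol_def)
qed (simp add: iter_partial_def deriv_symbol_def)

text \<open>Differentiating \<open>2 * K\<close> times in the direction of a largest component
  \<open>t\<close> suffices, since the weight is at most \<open>1 + n * t^2\<close>. If that
  component is 0, the weight is 1 and no derivative is taken. The direction depends on \<xi>, which
  is why the decay estimate asks for bounds on all derivatives of order at most
  \<open>2 * K\<close>.\<close>

lemma weight_le_deriv_symbol:
  fixes \<xi> :: "int ^ 'n"
  obtains js where "length js \<le> 2 * K" "weight \<xi> ^ K \<le> (1 + real CARD('n)) ^ K * cmod (deriv_symbol js \<xi>)"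
proof -
  obtain j where j: "\<And>i. \<bar>\<xi> $ i\<bar> \<le> \<bar>\<xi> $ j\<bar>"
  proof -
    have "finite (range (\<lambda>i. \<bar>\<xi> $ i\<bar>))" by simp
    then have "Max (range (\<lambda>i. \<bar>\<xi> $ i\<bar>)) \<in> range (\<lambda>i. \<bar>\<xi> $ i\<bar>)" by (rule Max_in) simp
    then obtain j where "Max (range (\<lambda>i. \<bar>\<xi> $ i\<bar>)) = \<bar>\<xi> $ j\<bar>" by (rule rangeE)
    then show ?thesis using that[of j] Max_ge[of "range (\<lambda>i. \<bar>\<xi> $ i\<bar>)"] by auto
  qed
  define t where "t = \<bar>real_of_int (\<xi> $ j)\<bar>"
  have "(real_of_int (\<xi> $ i))\<^sup>2 \<le> t\<^sup>2" for i
    unfolding t_def using j[of i] by (simp flip: abs_le_square_iff)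
  then have "(\<Sum>i\<in>UNIV. (real_of_int (\<xi> $ i))\<^sup>2) \<le> (\<Sum>i\<in>(UNIV :: 'n set). t\<^sup>2)"
    by (intro sum_mono)
  then have w: "weight \<xi> \<le> 1 + real CARD('n) * t\<^sup>2"
    by (simp add: weight_def l2_norm_squared)
  show ?thesis
  proof (cases "\<xi> $ j = 0")
    case True
    then have "weight \<xi> \<le> 1" using w by (simp add: t_def)
    then have "weight \<xi> ^ K \<le> (1 + real CARD('n)) ^ K"
      by (intro power_mono) auto
    then show ?thesis using that[of "[]"] by (simp add: deriv_symbol_def)
  next
    case False
    then have "1 \<le> t" by (simp add: t_def)
    then have "1 \<le> t\<^sup>2" by simp
    then have "weight \<xi> \<le> (1 + real CARD('n)) * t\<^sup>2" using w by (simp add: algebra_simps)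
    then have "weight \<xi> ^ K \<le> ((1 + real CARD('n)) * t\<^sup>2) ^ K" by (intro power_mono) auto
    also have "\<dots> = (1 + real CARD('n)) ^ K * t ^ (2 * K)"
      by (simp add: power_mult_distrib flip: power_mult)
    also have "t ^ (2 * K) = cmod (deriv_symbol (replicate (2 * K) j) \<xi>)"
      by (simp add: deriv_symbol_def t_def norm_power norm_mult prod_list_replicate)
    finally show ?thesis using that[of "replicate (2 * K) j"] by simp
  qed
qed

lemma torus_coeff_decay:
  fixes \<phi> :: "real ^ 'n \<Rightarrow> complex"
  assumes \<phi>: "\<phi> \<in> test_functions"
    and bound: "\<And>js x. length js \<le> 2 * K \<Longrightarrow> x \<in> period_box \<Longrightarrow> cmod (iter_partial js \<phi> x) \<le> B"
  shows "cmod (torus_coeff \<phi> \<xi>) * weight \<xi> ^ K \<le> (1 + real CARD('n)) ^ K * B"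
proof -
  obtain js where js: "length js \<le> 2 * K"
    "weight \<xi> ^ K \<le> (1 + real CARD('n)) ^ K * cmod (deriv_symbol js \<xi>)"
    by (rule weight_le_deriv_symbol)
  have "cmod (torus_coeff \<phi> \<xi>) * weight \<xi> ^ K
      \<le> cmod (torus_coeff \<phi> \<xi>) * ((1 + real CARD('n)) ^ K * cmod (deriv_symbol js \<xi>))"
    by (intro mult_left_mono js) auto
  also have "\<dots> = (1 + real CARD('n)) ^ K * cmod (torus_coeff (iter_partial js \<phi>) \<xi>)"
    by (simp add: torus_coeff_iter_partial[OF \<phi>] norm_mult)
  also have "\<dots> \<le> (1 + real CARD('n)) ^ K * B"
    by (intro mult_left_mono cmod_torus_coeff_le bound js
          test_function_continuous iter_partial_test_function \<phi>) auto
  finally show ?thesis .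
qed

lemma finite_lists_le: "finite {js :: 'n::finite list. length js \<le> N}"
  using finite_lists_length_le[of "UNIV :: 'n set" N] by simp

text \<open>The coefficients see only \<open>period_box\<close>, where compactness bounds each of
  the finitely many derivatives involved.\<close>

lemma rapidly_decreasing_torus_coeff:
  fixes \<phi> :: "real ^ 'n \<Rightarrow> complex"
  assumes \<phi>: "\<phi> \<in> test_functions"
  shows "rapidly_decreasing (torus_coeff \<phi>)"
  unfolding rapidly_decreasing_def
proof
  fix N
  have "\<exists>M\<ge>0. \<forall>x\<in>period_box. cmod (iter_partial js \<phi> x) \<le> M" for js
  proof -
    have "compact (iter_partial js \<phi> ` period_box)"
      by (intro compact_continuous_image test_function_continuous iter_partial_test_function \<phi>) auto
    then show ?thesis
      using compact_imp_bounded bounded_pos by (metis imageI less_imp_le)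
  qed
  then obtain M where M: "\<And>js. 0 \<le> M js" "\<And>js x. x \<in> period_box \<Longrightarrow> cmod (iter_partial js \<phi> x) \<le> M js"
    by metis
  have "M js \<le> sum M {js. length js \<le> 2 * N}" if "length js \<le> 2 * N" for js
    by (rule member_le_sum) (auto simp: that M finite_lists_le)
  then have "cmod (iter_partial js \<phi> x) \<le> sum M {js. length js \<le> 2 * N}"
    if "length js \<le> 2 * N" "x \<in> period_box" for js x
    using M(2) that order_trans by blast
  from torus_coeff_decay[OF \<phi> this]
  show "\<exists>C. \<forall>\<xi>. cmod (torus_coeff \<phi> \<xi>) * weight \<xi> ^ N \<le> C" by blast
qed

text \<open>The difference of the two sides is continuous and periodic, and its coefficients vanish
  because \<open>torus_coeff\<close> inverts \<open>fourier_series\<close> on rapidly decreasing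
  coefficients.\<close>

lemma fourier_inversion:
  assumes \<phi>: "\<phi> \<in> test_functions"
  shows "fourier_series (torus_coeff \<phi>) = \<phi>"
proof
  fix v
  note a = rapidly_decreasing_torus_coeff[OF \<phi>]
  note F = fourier_series_test_function[OF a]
  let ?\<psi> = "\<lambda>x. fourier_series (torus_coeff \<phi>) x - \<phi> x"
  have "?\<psi> v = 0"
  proof (rule torus_coeff_eq_0_imp_eq_0)
    show "continuous_on UNIV ?\<psi>"
      by (intro continuous_intros test_function_continuous F \<phi>)
    show "periodic ?\<psi>"
      using test_function_periodic[OF F] test_function_periodic[OF \<phi>] by (simp add: periodic_def)
    fix \<xi>
    have "integral period_box (\<lambda>x. ?\<psi> x * character (- \<xi>) x)
        = integral period_box (\<lambda>x. fourier_series (torus_coeff \<phi>) x * character (- \<xi>) x)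
          - integral period_box (\<lambda>x. \<phi> x * character (- \<xi>) x)"
      unfolding left_diff_distrib
      by (intro integral_diff integrable_continuous continuous_intros test_function_continuous F \<phi>)
    then have "torus_coeff ?\<psi> \<xi> = torus_coeff (fourier_series (torus_coeff \<phi>)) \<xi> - torus_coeff \<phi> \<xi>"
      by (simp add: torus_coeff_def diff_divide_distrib)
    then show "torus_coeff ?\<psi> \<xi> = 0"
      by (simp add: torus_coeff_fourier_series[OF a])
  qed
  then show "fourier_series (torus_coeff \<phi>) v = \<phi> v" by simp
qed

text \<open>The bound does not depend on \<open>x\<close>; it shows that the suprema in
  \<open>Ck_norm\<close> are taken over bounded sets and hence are genuine.\<close>

lemma cmod_iter_partial_le:
  assumes \<phi>: "\<phi> \<in> test_functions"
  shows "cmod (iter_partial js \<phi> x) \<le> (\<Sum>\<^sub>\<infinity>\<xi>. cmod (deriv_symbol js \<xi> * torus_coeff \<phi> \<xi>))"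
proof -
  note a = rapidly_decreasing_torus_coeff[OF \<phi>]
  have "iter_partial js \<phi> = fourier_series (\<lambda>\<xi>. deriv_symbol js \<xi> * torus_coeff \<phi> \<xi>)"
    using iter_partial_fourier_series[OF a] fourier_inversion[OF \<phi>] by metis
  then show ?thesis
    using cmod_fourier_series_le[OF rapidly_decreasing_mult[OF polynomial_growth_deriv_symbol a]]
    by simp
qed

lemma iter_partial_le_Ck_norm:
  assumes \<phi>: "\<phi> \<in> test_functions" and "length js \<le> N"
  shows "cmod (iter_partial js \<phi> x) \<le> Ck_norm N \<phi>"
proof -
  have bdd: "bdd_above (range (\<lambda>x. cmod (iter_partial js \<phi> x)))" for js
    by (rule bdd_aboveI2) (rule cmod_iter_partial_le[OF \<phi>])
  have le: "cmod (iter_partial js \<phi> x) \<le> (SUP x. cmod (iter_partial js \<phi> x))" for js x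
    by (rule cSUP_upper[OF UNIV_I bdd])
  have "(SUP x. cmod (iter_partial js \<phi> x)) \<le> Ck_norm N \<phi>"
    unfolding Ck_norm_def
    using assms(2) le order_trans[OF norm_ge_zero le]
    by (intro member_le_sum) (auto simp: finite_lists_le)
  then show ?thesis using le order_trans by blast
qed

lemma Ck_norm_le:
  assumes \<phi>: "\<phi> \<in> test_functions"
  shows "Ck_norm N \<phi> \<le> (\<Sum>js | length js \<le> N. \<Sum>\<^sub>\<infinity>\<xi>. cmod (deriv_symbol js \<xi> * torus_coeff \<phi> \<xi>))"
  unfolding Ck_norm_def
  by (intro sum_mono cSUP_least cmod_iter_partial_le[OF \<phi>]) auto

lemma torus_coeff_Ck_norm:
  fixes \<phi> :: "real ^ 'n \<Rightarrow> complex"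
  assumes "\<phi> \<in> test_functions"
  shows "cmod (torus_coeff \<phi> \<xi>) * weight \<xi> ^ K \<le> (1 + real CARD('n)) ^ K * Ck_norm (2 * K) \<phi>"
  by (intro torus_coeff_decay iter_partial_le_Ck_norm assms)

subsection \<open>Distributions and their Fourier coefficients\<close>

lemma Ck_norm_nonneg: "\<phi> \<in> test_functions \<Longrightarrow> 0 \<le> Ck_norm N \<phi>"
  by (rule order_trans[OF norm_ge_zero iter_partial_le_Ck_norm[where js = "[]"]]) simp_all

lemma distribution_add:
  assumes "u \<in> distributions" "\<phi> \<in> test_functions" "\<psi> \<in> test_functions"
  shows "u (\<lambda>x. \<phi> x + \<psi> x) = u \<phi> + u \<psi>"
  using assms by (simp add: distributions_def)

lemma distribution_cmult:
  assumes "u \<in> distributions" "\<phi> \<in> test_functions"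
  shows "u (\<lambda>x. c * \<phi> x) = c * u \<phi>"
  using assms by (simp add: distributions_def)

lemma distribution_bound:
  assumes "u \<in> distributions"
  obtains C N where "0 \<le> C" "\<And>\<phi>. \<phi> \<in> test_functions \<Longrightarrow> cmod (u \<phi>) \<le> C * Ck_norm N \<phi>"
proof -
  obtain C N where C: "\<And>\<phi>. \<phi> \<in> test_functions \<Longrightarrow> cmod (u \<phi>) \<le> C * Ck_norm N \<phi>"
    using assms unfolding distributions_def by blast
  have "cmod (u \<phi>) \<le> \<bar>C\<bar> * Ck_norm N \<phi>" if "\<phi> \<in> test_functions" for \<phi>
    using C[OF that] mult_right_mono[OF abs_ge_self[of C] Ck_norm_nonneg[OF that, of N]]
    by linarith
  then show ?thesis using that[of "\<bar>C\<bar>" N] by simp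
qed

text \<open>Turns the continuity estimate of a distribution into one by a weighted l1 norm of the
  coefficients. Applied to one frequency it yields the growth of the coefficients, applied to a tail
  the convergence of the expansion.\<close>

lemma Ck_norm_fourier_series_le:
  fixes a :: "int ^ 'n \<Rightarrow> complex"
  assumes a: "rapidly_decreasing a"
  shows "Ck_norm N (fourier_series a)
    \<le> real (card {js :: 'n list. length js \<le> N}) * (\<Sum>\<^sub>\<infinity>\<xi>. cmod (a \<xi>) * weight \<xi> ^ N)"
proof -
  have le: "cmod (deriv_symbol js \<xi> * a \<xi>) \<le> cmod (a \<xi>) * weight \<xi> ^ N"
    if "length js \<le> N" for js \<xi>
  proof -
    have "cmod (deriv_symbol js \<xi>) \<le> weight \<xi> ^ N"
      using cmod_deriv_symbol_le power_increasing[OF that weight_ge_1] by (rule order_trans)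
    then show ?thesis by (simp add: norm_mult mult_left_mono mult.commute)
  qed
  note sum = rapidly_decreasing_abs_summable[OF a, of N]
  have "Ck_norm N (fourier_series a)
      \<le> (\<Sum>js | length js \<le> N. \<Sum>\<^sub>\<infinity>\<xi>. cmod (deriv_symbol js \<xi> * a \<xi>))"
    using Ck_norm_le[OF fourier_series_test_function[OF a], of N]
    by (simp add: torus_coeff_fourier_series[OF a])
  also have "\<dots> \<le> (\<Sum>js | length (js :: 'n list) \<le> N. \<Sum>\<^sub>\<infinity>\<xi>. cmod (a \<xi>) * weight \<xi> ^ N)"
  proof (intro sum_mono infsum_mono sum)
    fix js :: "'n list" and \<xi>
    assume "js \<in> {js. length js \<le> N}"
    then show "cmod (deriv_symbol js \<xi> * a \<xi>) \<le> cmod (a \<xi>) * weight \<xi> ^ N"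
      using le by blast
  next
    fix js :: "'n list"
    assume "js \<in> {js. length js \<le> N}"
    then show "(\<lambda>\<xi>. cmod (deriv_symbol js \<xi> * a \<xi>)) summable_on UNIV"
      by (intro summable_on_comparison_test[OF sum] le) auto
  qed
  finally show ?thesis by simp
qed

lemma polynomial_growth_distribution:
  fixes u :: "(real ^ 'n \<Rightarrow> complex) \<Rightarrow> complex"
  assumes "u \<in> distributions"
  shows "polynomial_growth (\<lambda>\<xi>. u (character \<xi>))"
proof -
  obtain C N where C: "0 \<le> C" "\<And>\<phi>. \<phi> \<in> test_functions \<Longrightarrow> cmod (u \<phi>) \<le> C * Ck_norm N \<phi>"
    using distribution_bound[OF assms] by blast
  have "cmod (u (character \<xi>)) \<le> C * real (card {js :: 'n list. length js \<le> N}) * weight \<xi> ^ N" for \<xi>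
  proof -
    define d where "d = (\<lambda>\<eta>. if \<eta> = \<xi> then 1 else 0 :: complex)"
    have d: "rapidly_decreasing d"
      by (rule finite_support_rapidly_decreasing) (auto simp: d_def)
    have "(\<Sum>\<^sub>\<infinity>\<eta>. cmod (d \<eta>) * weight \<eta> ^ N) = (\<Sum>\<^sub>\<infinity>\<eta>\<in>{\<xi>}. weight \<eta> ^ N)"
      by (rule infsum_cong_neutral) (auto simp: d_def)
    moreover have "fourier_series d = character \<xi>"
      by (auto simp: d_def fourier_series_delta)
    ultimately have "Ck_norm N (character \<xi>) \<le> real (card {js :: 'n list. length js \<le> N}) * weight \<xi> ^ N"
      using Ck_norm_fourier_series_le[OF d, of N] by simp
    then show ?thesis
      using C(2)[OF character_test_function, of \<xi>] mult_left_mono[OF _ C(1)]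
      by (smt (verit) mult.assoc)
  qed
  then show ?thesis by (rule polynomial_growthI)
qed

lemma distribution_trigonometric_polynomial:
  assumes u: "u \<in> distributions" and "finite A"
  shows "u (fourier_series (\<lambda>\<xi>. if \<xi> \<in> A then a \<xi> else 0)) = (\<Sum>\<xi>\<in>A. a \<xi> * u (character \<xi>))"
  using \<open>finite A\<close>
proof (induction A rule: finite_induct)
  case empty
  have "fourier_series (\<lambda>\<xi>. 0) = (\<lambda>x :: real ^ 'a. 0 * character 0 x)"
    by (auto simp: fourier_series_def)
  then have "u (fourier_series (\<lambda>\<xi>. 0)) = 0 * u (character 0)"
    using distribution_cmult[OF u character_test_function] by metis
  then show ?case by simp
next
  case (insert \<eta> A)
  define b where "b = (\<lambda>\<xi>. if \<xi> \<in> A then a \<xi> else 0)"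
  define d where "d = (\<lambda>\<xi>. if \<xi> = \<eta> then a \<eta> else 0)"
  have bd: "rapidly_decreasing b" "rapidly_decreasing d"
    using insert.hyps
    by (auto intro!: finite_support_rapidly_decreasing simp: b_def d_def intro: rev_finite_subset)
  have split: "(\<lambda>\<xi>. if \<xi> \<in> insert \<eta> A then a \<xi> else 0) = (\<lambda>\<xi>. b \<xi> + d \<xi>)"
    using insert.hyps by (auto simp: b_def d_def)
  have "u (fourier_series (\<lambda>\<xi>. b \<xi> + d \<xi>)) = u (\<lambda>x. fourier_series b x + fourier_series d x)"
    by (rule arg_cong[where f = u]) (simp add: fun_eq_iff fourier_series_add bd)
  also have "\<dots> = u (fourier_series b) + u (fourier_series d)"
    by (intro distribution_add u fourier_series_test_function bd)
  also have "fourier_series d = (\<lambda>x. a \<eta> * character \<eta> x)"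
    by (auto simp: d_def fourier_series_delta)
  also have "u \<dots> = a \<eta> * u (character \<eta>)"
    by (intro distribution_cmult u character_test_function)
  finally show ?case
    unfolding split using insert by (simp add: b_def)
qed

text \<open>For a finite set \<open>A\<close> of frequencies, \<phi> splits into a trigonometric
  polynomial, on which linearity suffices, and the series \<open>r\<close> of the remaining
  coefficients; continuity bounds \<open>u\<close> on the latter by a multiple of the tail of the
  convergent sum of \<open>g\<close>.\<close>

lemma distribution_expansion:
  fixes u :: "(real ^ 'n \<Rightarrow> complex) \<Rightarrow> complex"
  assumes u: "u \<in> distributions" and \<phi>: "\<phi> \<in> test_functions"
  shows "((\<lambda>\<xi>. torus_coeff \<phi> \<xi> * u (character \<xi>)) has_sum u \<phi>) UNIV"
proof -
  define a where "a = torus_coeff \<phi>"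
  have a: "rapidly_decreasing a"
    unfolding a_def by (rule rapidly_decreasing_torus_coeff[OF \<phi>])
  obtain C N where C: "0 \<le> C" "\<And>\<phi>. \<phi> \<in> test_functions \<Longrightarrow> cmod (u \<phi>) \<le> C * Ck_norm N \<phi>"
    using distribution_bound[OF u] by blast
  define g where "g \<xi> = cmod (a \<xi>) * weight \<xi> ^ N" for \<xi>
  have g: "g summable_on UNIV"
    unfolding g_def by (rule rapidly_decreasing_abs_summable[OF a])
  define D where "D = C * real (card {js :: 'n list. length js \<le> N})"
  have tail: "cmod ((\<Sum>\<xi>\<in>A. a \<xi> * u (character \<xi>)) - u \<phi>) \<le> D * (infsum g UNIV - sum g A)"
    if "finite A" for A
  proof -
    define b where "b = (\<lambda>\<xi>. if \<xi> \<in> A then a \<xi> else 0)"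
    define r where "r = (\<lambda>\<xi>. if \<xi> \<in> A then 0 else a \<xi>)"
    have b: "rapidly_decreasing b"
      using that by (auto intro!: finite_support_rapidly_decreasing simp: b_def intro: rev_finite_subset)
    have r: "rapidly_decreasing r"
    proof -
      have "rapidly_decreasing (\<lambda>\<xi>. (if \<xi> \<in> A then 0 else 1) * a \<xi>)"
        by (intro rapidly_decreasing_mult a polynomial_growthI[of _ 1 0]) auto
      moreover have "r = (\<lambda>\<xi>. (if \<xi> \<in> A then 0 else 1) * a \<xi>)" by (auto simp: r_def)
      ultimately show ?thesis by simp
    qed
    have a_split: "a = (\<lambda>\<xi>. b \<xi> + r \<xi>)" by (auto simp: b_def r_def)
    have "\<phi> = fourier_series a"
      unfolding a_def by (rule fourier_inversion[OF \<phi>, symmetric])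
    also have "\<dots> = fourier_series (\<lambda>\<xi>. b \<xi> + r \<xi>)"
      by (rule arg_cong[OF a_split])
    also have "\<dots> = (\<lambda>x. fourier_series b x + fourier_series r x)"
      by (intro ext fourier_series_add b r)
    finally have "u \<phi> = u (\<lambda>x. fourier_series b x + fourier_series r x)"
      by (rule arg_cong)
    also have "\<dots> = u (fourier_series b) + u (fourier_series r)"
      by (rule distribution_add[OF u fourier_series_test_function[OF b] fourier_series_test_function[OF r]])
    finally have "u \<phi> = u (fourier_series b) + u (fourier_series r)" .
    moreover have "u (fourier_series b) = (\<Sum>\<xi>\<in>A. a \<xi> * u (character \<xi>))"
      unfolding b_def by (rule distribution_trigonometric_polynomial[OF u that])
    ultimately have "cmod ((\<Sum>\<xi>\<in>A. a \<xi> * u (character \<xi>)) - u \<phi>) = cmod (u (fourier_series r))"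
      by (simp add: norm_minus_commute)
    also have "\<dots> \<le> C * Ck_norm N (fourier_series r)"
      by (rule C(2)[OF fourier_series_test_function[OF r]])
    also have "\<dots> \<le> D * (\<Sum>\<^sub>\<infinity>\<xi>. cmod (r \<xi>) * weight \<xi> ^ N)"
      unfolding D_def mult.assoc by (intro mult_left_mono Ck_norm_fourier_series_le r C(1))
    also have "(\<Sum>\<^sub>\<infinity>\<xi>. cmod (r \<xi>) * weight \<xi> ^ N) = infsum g (UNIV - A)"
      by (rule infsum_cong_neutral) (auto simp: r_def g_def)
    also have "\<dots> = infsum g UNIV - sum g A"
      using infsum_Diff[OF g, of A] that by simp
    finally show ?thesis .
  qed
  have "((\<lambda>A. D * (infsum g UNIV - sum g A)) \<longlongrightarrow> D * (infsum g UNIV - infsum g UNIV))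
      (finite_subsets_at_top UNIV)"
    by (rule tendsto_mult_left[OF tendsto_diff[OF tendsto_const infsum_tendsto[OF g]]])
  then have lim: "((\<lambda>A. D * (infsum g UNIV - sum g A)) \<longlongrightarrow> 0) (finite_subsets_at_top UNIV)"
    by simp
  have "\<forall>\<^sub>F A in finite_subsets_at_top UNIV.
      cmod ((\<Sum>\<xi>\<in>A. a \<xi> * u (character \<xi>)) - u \<phi>) \<le> D * (infsum g UNIV - sum g A)"
    by (rule eventually_finite_subsets_at_top_weakI) (rule tail)
  then have "((\<lambda>A. (\<Sum>\<xi>\<in>A. a \<xi> * u (character \<xi>)) - u \<phi>) \<longlongrightarrow> 0) (finite_subsets_at_top UNIV)"
    using lim by (rule Lim_null_comparison)
  then show ?thesis
    unfolding has_sum_def a_def[symmetric] by (rule LIM_zero_cancel)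
qed

lemma character_value: "u (character \<xi>) = complex_of_real ((2 * pi) ^ CARD('n)) * fourier_coeff u (- \<xi>)"
  for u :: "(real ^ 'n \<Rightarrow> complex) \<Rightarrow> complex"
  by (simp add: fourier_coeff_def)

lemma distribution_eqI:
  assumes u: "u \<in> distributions" and v: "v \<in> distributions"
    and eq: "\<And>\<xi>. fourier_coeff u \<xi> = fourier_coeff v \<xi>"
  shows "u = v"
proof
  fix \<phi>
  show "u \<phi> = v \<phi>"
  proof (cases "\<phi> \<in> test_functions")
    case True
    have "u (character \<xi>) = v (character \<xi>)" for \<xi>
      by (simp add: character_value eq)
    then show ?thesis
      using has_sum_unique[OF distribution_expansion[OF u True]] distribution_expansion[OF v True]
      by simp
  next
    case False
    then show ?thesis using u v by (simp add: distributions_def)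
  qed
qed

lemma polynomial_growth_fourier_coeff:
  fixes u :: "(real ^ 'n \<Rightarrow> complex) \<Rightarrow> complex"
  assumes "u \<in> distributions"
  shows "polynomial_growth (fourier_coeff u)"
proof -
  have "polynomial_growth (\<lambda>\<xi>. (1 / complex_of_real ((2 * pi) ^ CARD('n))) * u (character (- \<xi>)))"
    by (intro polynomial_growth_mult polynomial_growth_const
          polynomial_growth_minus[OF polynomial_growth_distribution] assms)
  then show ?thesis by (simp add: fourier_coeff_def[abs_def])
qed

section \<open>Distributions with prescribed Fourier coefficients\<close>

lemma test_functions_add:
  assumes "\<phi> \<in> test_functions" "\<psi> \<in> test_functions"
  shows "(\<lambda>x. \<phi> x + \<psi> x) \<in> test_functions"
    "torus_coeff (\<lambda>x. \<phi> x + \<psi> x) = (\<lambda>\<xi>. torus_coeff \<phi> \<xi> + torus_coeff \<psi> \<xi>)"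
proof -
  note rd = rapidly_decreasing_torus_coeff[OF assms(1)] rapidly_decreasing_torus_coeff[OF assms(2)]
  have eq: "(\<lambda>x. \<phi> x + \<psi> x) = fourier_series (\<lambda>\<xi>. torus_coeff \<phi> \<xi> + torus_coeff \<psi> \<xi>)"
    using fourier_inversion[OF assms(1)] fourier_inversion[OF assms(2)]
    by (intro ext) (simp add: fourier_series_add rd)
  show "(\<lambda>x. \<phi> x + \<psi> x) \<in> test_functions"
    unfolding eq by (intro fourier_series_test_function rapidly_decreasing_add rd)
  show "torus_coeff (\<lambda>x. \<phi> x + \<psi> x) = (\<lambda>\<xi>. torus_coeff \<phi> \<xi> + torus_coeff \<psi> \<xi>)"
    unfolding eq by (intro ext torus_coeff_fourier_series rapidly_decreasing_add rd)
qed

lemma test_functions_cmult: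
  assumes "\<phi> \<in> test_functions"
  shows "(\<lambda>x. c * \<phi> x) \<in> test_functions"
    "torus_coeff (\<lambda>x. c * \<phi> x) = (\<lambda>\<xi>. c * torus_coeff \<phi> \<xi>)"
proof -
  have rd: "rapidly_decreasing (\<lambda>\<xi>. c * torus_coeff \<phi> \<xi>)"
    by (intro rapidly_decreasing_mult polynomial_growth_const rapidly_decreasing_torus_coeff assms)
  have eq: "(\<lambda>x. c * \<phi> x) = fourier_series (\<lambda>\<xi>. c * torus_coeff \<phi> \<xi>)"
    using fourier_inversion[OF assms] by (intro ext) (simp add: fourier_series_cmult)
  show "(\<lambda>x. c * \<phi> x) \<in> test_functions"
    unfolding eq by (rule fourier_series_test_function[OF rd])
  show "torus_coeff (\<lambda>x. c * \<phi> x) = (\<lambda>\<xi>. c * torus_coeff \<phi> \<xi>)"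
    unfolding eq by (intro ext torus_coeff_fourier_series rd)
qed

text \<open>The bracket is bilinear, hence it pairs the frequency \<open>\<xi>\<close> of a test function with the
  frequency \<open>- \<xi>\<close> of the distribution.\<close>

definition coeff_distribution :: "(int ^ 'n \<Rightarrow> complex) \<Rightarrow> (real ^ 'n \<Rightarrow> complex) \<Rightarrow> complex" where
  "coeff_distribution c \<phi> = (if \<phi> \<in> test_functions
     then complex_of_real ((2 * pi) ^ CARD('n)) * (\<Sum>\<^sub>\<infinity>\<xi>. c (- \<xi>) * torus_coeff \<phi> \<xi>) else 0)"

lemma coeff_distribution_in_distributions:
  fixes c :: "int ^ 'n \<Rightarrow> complex"
  assumes "polynomial_growth c"
  shows "coeff_distribution c \<in> distributions"
proof -
  define V where "V = complex_of_real ((2 * pi) ^ CARD('n))"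
  obtain C M where C: "0 \<le> C" "\<And>\<xi>. cmod (c \<xi>) \<le> C * weight \<xi> ^ M"
    using assms polynomial_growthE by blast
  have rd: "rapidly_decreasing (\<lambda>\<xi>. c (- \<xi>) * torus_coeff \<phi> \<xi>)" if "\<phi> \<in> test_functions" for \<phi>
    by (intro rapidly_decreasing_mult polynomial_growth_minus assms rapidly_decreasing_torus_coeff that)
  then have abs: "(\<lambda>\<xi>. cmod (c (- \<xi>) * torus_coeff \<phi> \<xi>)) summable_on UNIV"
    if "\<phi> \<in> test_functions" for \<phi>
    using rapidly_decreasing_summable that by blast
  have summable: "(\<lambda>\<xi>. c (- \<xi>) * torus_coeff \<phi> \<xi>) summable_on UNIV"
    if "\<phi> \<in> test_functions" for \<phi>
    by (rule abs_summable_summable[OF abs[OF that]])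
  \<comment> \<open>\<open>M\<close> powers of the weight absorb the growth of \<open>c\<close> and
    \<open>CARD('n)\<close> more make the series converge; they are paid for by \<open>2 * K\<close>
    derivatives of \<phi>.\<close>
  define K where "K = M + CARD('n)"
  define S where "S = (\<Sum>\<^sub>\<infinity>\<xi>::int ^ 'n. 1 / weight \<xi> ^ CARD('n))"
  have bound: "cmod (coeff_distribution c \<phi>)
      \<le> (cmod V * C * (1 + real CARD('n)) ^ K * S) * Ck_norm (2 * K) \<phi>" if "\<phi> \<in> test_functions" for \<phi>
  proof -
    define B where "B = (1 + real CARD('n)) ^ K * Ck_norm (2 * K) \<phi>"
    have le: "cmod (c (- \<xi>) * torus_coeff \<phi> \<xi>) \<le> C * B * (1 / weight \<xi> ^ CARD('n))" for \<xi>
    proof -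
      have "cmod (c (- \<xi>) * torus_coeff \<phi> \<xi>) \<le> C * weight \<xi> ^ M * cmod (torus_coeff \<phi> \<xi>)"
        using C(2)[of "- \<xi>"] by (simp add: norm_mult mult_right_mono)
      also have "\<dots> = C * (cmod (torus_coeff \<phi> \<xi>) * weight \<xi> ^ K) * (1 / weight \<xi> ^ CARD('n))"
        by (simp add: K_def power_add)
      also have "\<dots> \<le> C * B * (1 / weight \<xi> ^ CARD('n))"
        using torus_coeff_Ck_norm[OF that, of \<xi> K] C(1)
        by (intro mult_right_mono mult_left_mono) (auto simp: B_def)
      finally show ?thesis .
    qed
    have "cmod (\<Sum>\<^sub>\<infinity>\<xi>. c (- \<xi>) * torus_coeff \<phi> \<xi>) \<le> (\<Sum>\<^sub>\<infinity>\<xi>. cmod (c (- \<xi>) * torus_coeff \<phi> \<xi>))"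
      by (rule norm_infsum_bound[OF abs[OF that]])
    also have "\<dots> \<le> (\<Sum>\<^sub>\<infinity>\<xi>::int ^ 'n. C * B * (1 / weight \<xi> ^ CARD('n)))"
      by (intro infsum_mono abs that summable_on_cmult_right summable_inverse_weight le)
    also have "\<dots> = C * B * S"
      unfolding S_def by (rule infsum_cmult_right')
    finally have "cmod V * cmod (\<Sum>\<^sub>\<infinity>\<xi>. c (- \<xi>) * torus_coeff \<phi> \<xi>) \<le> cmod V * (C * B * S)"
      by (rule mult_left_mono) simp
    moreover have "cmod (coeff_distribution c \<phi>) = cmod V * cmod (\<Sum>\<^sub>\<infinity>\<xi>. c (- \<xi>) * torus_coeff \<phi> \<xi>)"
      unfolding coeff_distribution_def V_def[symmetric] using that by (simp only: if_True norm_mult)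
    ultimately show ?thesis
      by (simp add: B_def mult_ac)
  qed
  have add: "coeff_distribution c (\<lambda>x. \<phi> x + \<psi> x) = coeff_distribution c \<phi> + coeff_distribution c \<psi>"
    if "\<phi> \<in> test_functions" "\<psi> \<in> test_functions" for \<phi> \<psi>
    using that test_functions_add[OF that] infsum_add[OF summable summable]
    by (simp add: coeff_distribution_def distrib_left)
  have cmult: "coeff_distribution c (\<lambda>x. k * \<phi> x) = k * coeff_distribution c \<phi>"
    if "\<phi> \<in> test_functions" for \<phi> k
    using that test_functions_cmult[OF that, of k]
    by (simp add: coeff_distribution_def mult.left_commute[of _ k] infsum_cmult_right')
  show ?thesis
    unfolding distributions_def using bound add cmult
    by (auto simp: coeff_distribution_def)
qed

lemma torus_coeff_character: "torus_coeff (character \<xi>) \<eta> = (if \<eta> = \<xi> then 1 else 0)"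
proof -
  define d where "d = (\<lambda>\<eta>. if \<eta> = \<xi> then 1 else 0 :: complex)"
  have d: "rapidly_decreasing d"
    by (rule finite_support_rapidly_decreasing) (auto simp: d_def)
  have "fourier_series d = character \<xi>" by (auto simp: d_def fourier_series_delta)
  then show ?thesis using torus_coeff_fourier_series[OF d, of \<eta>] by (simp add: d_def)
qed

lemma fourier_coeff_coeff_distribution [simp]: "fourier_coeff (coeff_distribution c) \<xi> = c \<xi>"
proof -
  have "(\<Sum>\<^sub>\<infinity>\<eta>. c (- \<eta>) * torus_coeff (character (- \<xi>)) \<eta>) = (\<Sum>\<^sub>\<infinity>\<eta>\<in>{- \<xi>}. c (- \<eta>))"
    by (rule infsum_cong_neutral) (auto simp: torus_coeff_character)
  then show ?thesis
    by (simp add: fourier_coeff_def coeff_distribution_def character_test_function)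
qed

subsection \<open>Multipliers, their transposes and the annihilator\<close>

lemma weight_powr_le: "weight \<xi> powr s \<le> weight \<xi> ^ nat \<lceil>s\<rceil>"
proof -
  have "weight \<xi> powr s \<le> weight \<xi> powr real (nat \<lceil>s\<rceil>)"
    by (intro powr_mono weight_ge_1) linarith
  then show ?thesis by (simp add: powr_realpow)
qed

lemma polynomial_growth_symbol:
  assumes "symbol_of_order m p"
  shows "polynomial_growth p"
proof -
  obtain C where C: "0 < C" "\<And>\<xi>. cmod (p \<xi>) \<le> C * weight \<xi> powr (m / 2)"
    using assms by (auto simp: symbol_of_order_def weight_def)
  show ?thesis
  proof (rule polynomial_growthI)
    fix \<xi>
    show "cmod (p \<xi>) \<le> C * weight \<xi> ^ nat \<lceil>m / 2\<rceil>"
      using C(2)[of \<xi>] mult_left_mono[OF weight_powr_le, of C \<xi> "m / 2"] C(1) by linarith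
  qed
qed

text \<open>Resolves the definite description: \<open>coeff_distribution\<close> supplies a
  candidate, and \<open>distribution_eqI\<close> shows that it is the only one.\<close>

lemma multiplier_props:
  assumes p: "polynomial_growth p" and u: "u \<in> distributions"
  shows "multiplier p u \<in> distributions"
    and "fourier_coeff (multiplier p u) \<xi> = p \<xi> * fourier_coeff u \<xi>"
proof -
  have "\<exists>!v. v \<in> distributions \<and> (\<forall>\<xi>. fourier_coeff v \<xi> = p \<xi> * fourier_coeff u \<xi>)"
  proof (rule ex_ex1I)
    have "polynomial_growth (\<lambda>\<xi>. p \<xi> * fourier_coeff u \<xi>)"
      by (intro polynomial_growth_mult p polynomial_growth_fourier_coeff u)
    then show "\<exists>v. v \<in> distributions \<and> (\<forall>\<xi>. fourier_coeff v \<xi> = p \<xi> * fourier_coeff u \<xi>)"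
      using coeff_distribution_in_distributions fourier_coeff_coeff_distribution by blast
  qed (auto intro: distribution_eqI)
  from theI'[OF this] show "multiplier p u \<in> distributions"
    "fourier_coeff (multiplier p u) \<xi> = p \<xi> * fourier_coeff u \<xi>"
    unfolding multiplier_def by blast+
qed

lemma multiplier_eqI:
  assumes "polynomial_growth p" "u \<in> distributions" "v \<in> distributions"
    and "\<And>\<xi>. fourier_coeff v \<xi> = p \<xi> * fourier_coeff u \<xi>"
  shows "multiplier p u = v"
  by (rule distribution_eqI) (simp_all add: multiplier_props assms)

text \<open>Distributions separate test functions; this is the uniqueness behind
  \<open>transpose_op\<close>.\<close>

lemma test_function_eqI:
  assumes "\<phi> \<in> test_functions" "\<psi> \<in> test_functions"
    and eq: "\<And>u. u \<in> distributions \<Longrightarrow> u \<phi> = u \<psi>"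
  shows "\<phi> = \<psi>"
proof -
  have "torus_coeff \<phi> \<eta> = torus_coeff \<psi> \<eta>" for \<eta>
  proof -
    \<comment> \<open>Because of the reflection in the pairing, a single coefficient at - \<eta>
      makes a distribution that reads off the coefficient of a test function at \<eta>.\<close>
    define d where "d = (\<lambda>\<xi>. if \<xi> = - \<eta> then 1 else 0 :: complex)"
    have "polynomial_growth d" by (rule polynomial_growthI[of _ 1 0]) (simp add: d_def)
    then have "coeff_distribution d \<phi> = coeff_distribution d \<psi>"
      by (intro eq coeff_distribution_in_distributions)
    moreover have "(\<Sum>\<^sub>\<infinity>\<xi>. d (- \<xi>) * f \<xi>) = (\<Sum>\<^sub>\<infinity>\<xi>\<in>{\<eta>}. f \<xi>)" for f
      by (rule infsum_cong_neutral) (auto simp: d_def)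
    ultimately show ?thesis
      using assms(1,2) by (simp add: coeff_distribution_def)
  qed
  then show ?thesis
    using fourier_inversion[OF assms(1)] fourier_inversion[OF assms(2)] by presburger
qed

text \<open>By \<open>character_value\<close>, \<open>u (character \<xi>)\<close> carries the
  coefficient of \<open>u\<close> at - \<xi>, which the multiplier scales by
  \<open>p (- \<xi>)\<close>. In the expansion of the bracket this factor can be moved to the test
  function.\<close>

lemma transpose_multiplier:
  assumes p: "polynomial_growth p" and \<phi>: "\<phi> \<in> test_functions"
  shows "transpose_op (multiplier p) \<phi> = fourier_series (\<lambda>\<xi>. p (- \<xi>) * torus_coeff \<phi> \<xi>)"
    (is "_ = ?\<psi>")
proof -
  have rd: "rapidly_decreasing (\<lambda>\<xi>. p (- \<xi>) * torus_coeff \<phi> \<xi>)"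
    by (intro rapidly_decreasing_mult polynomial_growth_minus p rapidly_decreasing_torus_coeff \<phi>)
  note \<psi> = fourier_series_test_function[OF rd]
  have adj: "multiplier p u \<phi> = u ?\<psi>" if u: "u \<in> distributions" for u
  proof -
    have "((\<lambda>\<xi>. torus_coeff \<phi> \<xi> * multiplier p u (character \<xi>)) has_sum multiplier p u \<phi>) UNIV"
      by (intro distribution_expansion multiplier_props p u \<phi>)
    moreover have "((\<lambda>\<xi>. p (- \<xi>) * torus_coeff \<phi> \<xi> * u (character \<xi>)) has_sum u ?\<psi>) UNIV"
      using distribution_expansion[OF u \<psi>] by (simp add: torus_coeff_fourier_series[OF rd])
    moreover have "torus_coeff \<phi> \<xi> * multiplier p u (character \<xi>)
        = p (- \<xi>) * torus_coeff \<phi> \<xi> * u (character \<xi>)" for \<xi>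
      by (simp add: character_value multiplier_props p u)
    ultimately show ?thesis
      using has_sum_unique by auto
  qed
  show ?thesis
    unfolding transpose_op_def
  proof (rule the_equality)
    show "?\<psi> \<in> test_functions \<and> (\<forall>u\<in>distributions. multiplier p u \<phi> = u ?\<psi>)"
      using \<psi> adj by blast
  next
    fix \<theta>
    assume "\<theta> \<in> test_functions \<and> (\<forall>u\<in>distributions. multiplier p u \<phi> = u \<theta>)"
    then show "\<theta> = ?\<psi>"
      using \<psi> adj by (intro test_function_eqI) auto
  qed
qed

text \<open>If \<open>p \<xi> = 0\<close>, then \<open>character (- \<xi>)\<close> lies in the
  kernel and tests the coefficient at \<xi>. Conversely, for \<phi> in the kernel, every term of the
  expansion of \<open>f \<phi>\<close> vanishes: where \<open>p (- \<xi>)\<close> is nonzero the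
  coefficient of \<phi> is 0, elsewhere that of \<open>f\<close>.\<close>

lemma annihilator_smooth_kernel:
  assumes p: "polynomial_growth p"
  shows "annihilator (smooth_kernel (transpose_op (multiplier p)))
    = {f \<in> distributions. \<forall>\<xi>. p \<xi> = 0 \<longrightarrow> fourier_coeff f \<xi> = 0}"
proof (intro set_eqI iffI)
  fix f
  assume f: "f \<in> annihilator (smooth_kernel (transpose_op (multiplier p)))"
  have "fourier_coeff f \<xi> = 0" if "p \<xi> = 0" for \<xi>
  proof -
    have "(\<lambda>\<eta>. p (- \<eta>) * torus_coeff (character (- \<xi>)) \<eta>) = (\<lambda>\<eta>. 0)"
      using that by (auto simp: torus_coeff_character)
    then have "transpose_op (multiplier p) (character (- \<xi>)) = (\<lambda>x. 0)"
      unfolding transpose_multiplier[OF p character_test_function]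
      by (auto simp: fourier_series_def)
    then have "character (- \<xi>) \<in> smooth_kernel (transpose_op (multiplier p))"
      by (simp add: smooth_kernel_def character_test_function)
    then show ?thesis
      using f by (simp add: annihilator_def fourier_coeff_def)
  qed
  then show "f \<in> {f \<in> distributions. \<forall>\<xi>. p \<xi> = 0 \<longrightarrow> fourier_coeff f \<xi> = 0}"
    using f by (simp add: annihilator_def)
next
  fix f
  assume f: "f \<in> {f \<in> distributions. \<forall>\<xi>. p \<xi> = 0 \<longrightarrow> fourier_coeff f \<xi> = 0}"
  have "f \<phi> = 0" if \<phi>: "\<phi> \<in> test_functions" and ker: "transpose_op (multiplier p) \<phi> = (\<lambda>x. 0)" for \<phi>
  proof -
    have rd: "rapidly_decreasing (\<lambda>\<xi>. p (- \<xi>) * torus_coeff \<phi> \<xi>)"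
      by (intro rapidly_decreasing_mult polynomial_growth_minus p rapidly_decreasing_torus_coeff \<phi>)
    have "p (- \<xi>) * torus_coeff \<phi> \<xi> = 0" for \<xi>
      using torus_coeff_fourier_series[OF rd, of \<xi>] ker
      by (simp add: transpose_multiplier[OF p \<phi>] torus_coeff_def)
    then have zero: "torus_coeff \<phi> \<xi> * f (character \<xi>) = 0" for \<xi>
      using f by (auto simp: character_value)
    have "((\<lambda>\<xi>. torus_coeff \<phi> \<xi> * f (character \<xi>)) has_sum f \<phi>) UNIV"
      using f by (intro distribution_expansion \<phi>) auto
    then show ?thesis
      by (rule has_sum_unique) (simp only: zero has_sum_0_simp)
  qed
  then show "f \<in> annihilator (smooth_kernel (transpose_op (multiplier p)))"
    using f by (simp add: annihilator_def smooth_kernel_def)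
qed

subsection \<open>Sobolev spaces\<close>

lemma sobolev_iff: "u \<in> sobolev k \<longleftrightarrow> u \<in> distributions \<and>
    (\<lambda>\<xi>. weight \<xi> powr k * (cmod (fourier_coeff u \<xi>))\<^sup>2) summable_on UNIV"
  by (simp add: sobolev_def weight_def)

lemma sobolev_norm_weight:
  "sobolev_norm k u = sqrt (\<Sum>\<^sub>\<infinity>\<xi>. weight \<xi> powr k * (cmod (fourier_coeff u \<xi>))\<^sup>2)"
  by (simp add: sobolev_norm_def weight_def)

lemma fourier_coeff_diff: "fourier_coeff (u - v) \<xi> = fourier_coeff u \<xi> - fourier_coeff v \<xi>"
  by (simp add: fourier_coeff_def diff_divide_distrib)

text \<open>Minkowski's inequality on finite sets, with \<open>sqrt (w x)\<close> absorbed into the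
  entries; the bound is uniform in the finite set and so gives both summability and the inequality
  for the full sums.\<close>

lemma weighted_l2_triangle:
  fixes a b :: "'a \<Rightarrow> complex" and w :: "'a \<Rightarrow> real"
  assumes w: "\<And>x. 0 \<le> w x"
    and a: "(\<lambda>x. w x * (cmod (a x))\<^sup>2) summable_on UNIV"
    and b: "(\<lambda>x. w x * (cmod (b x))\<^sup>2) summable_on UNIV"
  shows "(\<lambda>x. w x * (cmod (a x - b x))\<^sup>2) summable_on UNIV" (is ?summable)
    and "sqrt (\<Sum>\<^sub>\<infinity>x. w x * (cmod (a x - b x))\<^sup>2)
      \<le> sqrt (\<Sum>\<^sub>\<infinity>x. w x * (cmod (a x))\<^sup>2) + sqrt (\<Sum>\<^sub>\<infinity>x. w x * (cmod (b x))\<^sup>2)" (is ?le)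
proof -
  define A where "A = sqrt (\<Sum>\<^sub>\<infinity>x. w x * (cmod (a x))\<^sup>2)"
  define B where "B = sqrt (\<Sum>\<^sub>\<infinity>x. w x * (cmod (b x))\<^sup>2)"
  have AB: "0 \<le> A" "0 \<le> B" by (auto simp: A_def B_def w intro!: infsum_nonneg)
  have L2: "L2_set (\<lambda>x. sqrt (w x) * cmod (c x)) F = sqrt (\<Sum>x\<in>F. w x * (cmod (c x))\<^sup>2)"
    for c :: "'a \<Rightarrow> complex" and F
    by (simp add: L2_set_def power_mult_distrib w)
  have fin: "(\<Sum>x\<in>F. w x * (cmod (a x - b x))\<^sup>2) \<le> (A + B)\<^sup>2" if "finite F" for F
  proof -
    have "sqrt (\<Sum>x\<in>F. w x * (cmod (a x - b x))\<^sup>2)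
        \<le> L2_set (\<lambda>x. sqrt (w x) * cmod (a x) + sqrt (w x) * cmod (b x)) F"
      unfolding L2[symmetric] distrib_left[symmetric]
      by (intro L2_set_mono mult_left_mono norm_triangle_ineq4) (auto simp: w)
    also have "\<dots> \<le> sqrt (\<Sum>x\<in>F. w x * (cmod (a x))\<^sup>2) + sqrt (\<Sum>x\<in>F. w x * (cmod (b x))\<^sup>2)"
      unfolding L2[symmetric] by (rule L2_set_triangle_ineq)
    also have "\<dots> \<le> A + B"
      unfolding A_def B_def
      by (intro add_mono real_sqrt_le_mono finite_sum_le_infsum a b that) (auto simp: w)
    finally show ?thesis
      by (rule sqrt_le_D)
  qed
  show ?summable
    by (rule nonneg_bdd_above_summable_on) (auto simp: w intro!: bdd_aboveI2 fin)
  then have "(\<Sum>\<^sub>\<infinity>x. w x * (cmod (a x - b x))\<^sup>2) \<le> (A + B)\<^sup>2"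
    by (rule infsum_le_finite_sums) (rule fin)
  then show ?le
    using AB real_le_lsqrt unfolding A_def[symmetric] B_def[symmetric] by (simp add: real_le_lsqrt)
qed

lemma sobolev_diff_summable:
  assumes "u \<in> sobolev k" "v \<in> sobolev k"
  shows "(\<lambda>\<xi>. weight \<xi> powr k * (cmod (fourier_coeff (u - v) \<xi>))\<^sup>2) summable_on UNIV"
  unfolding fourier_coeff_diff
  using assms by (intro weighted_l2_triangle) (auto simp: sobolev_iff)

text \<open>Continuity of each Fourier coefficient on H^k, used for the separation axiom of the
  metric and for closedness of the annihilator.\<close>

lemma fourier_coeff_le_sobolev_norm:
  assumes "u \<in> sobolev k" "v \<in> sobolev k"
  shows "sqrt (weight \<xi> powr k) * cmod (fourier_coeff u \<xi> - fourier_coeff v \<xi>) \<le> sobolev_norm k (u - v)"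
proof -
  have "(\<Sum>\<xi>\<in>{\<xi>}. weight \<xi> powr k * (cmod (fourier_coeff (u - v) \<xi>))\<^sup>2)
      \<le> (\<Sum>\<^sub>\<infinity>\<xi>. weight \<xi> powr k * (cmod (fourier_coeff (u - v) \<xi>))\<^sup>2)"
    by (rule finite_sum_le_infsum[OF sobolev_diff_summable[OF assms]]) auto
  then have "sqrt (weight \<xi> powr k * (cmod (fourier_coeff (u - v) \<xi>))\<^sup>2) \<le> sobolev_norm k (u - v)"
    unfolding sobolev_norm_weight by simp
  then show ?thesis
    by (simp add: real_sqrt_mult fourier_coeff_diff)
qed

lemma Metric_space_sobolev:
  "Metric_space (sobolev k :: ((real ^ 'n \<Rightarrow> complex) \<Rightarrow> complex) set) (\<lambda>u v. sobolev_norm k (u - v))"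
proof
  fix u v :: "(real ^ 'n \<Rightarrow> complex) \<Rightarrow> complex"
  show "0 \<le> sobolev_norm k (u - v)"
    by (simp add: sobolev_norm_weight infsum_nonneg)
  show "sobolev_norm k (u - v) = sobolev_norm k (v - u)"
    by (simp add: sobolev_norm_weight fourier_coeff_diff norm_minus_commute)
next
  fix u v :: "(real ^ 'n \<Rightarrow> complex) \<Rightarrow> complex"
  assume uv: "u \<in> sobolev k" "v \<in> sobolev k"
  show "sobolev_norm k (u - v) = 0 \<longleftrightarrow> u = v"
  proof
    assume zero: "sobolev_norm k (u - v) = 0"
    have "cmod (fourier_coeff u \<xi> - fourier_coeff v \<xi>) = 0" for \<xi>
    proof -
      have "0 < sqrt (weight \<xi> powr k)" by simp
      then show ?thesis
        using fourier_coeff_le_sobolev_norm[OF uv, of \<xi>] zero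
        by (metis mult_le_0_iff norm_le_zero_iff norm_zero not_le)
    qed
    then show "u = v"
      using uv by (intro distribution_eqI) (auto simp: sobolev_iff)
  qed (simp add: sobolev_norm_weight fourier_coeff_def)
next
  fix u v w :: "(real ^ 'n \<Rightarrow> complex) \<Rightarrow> complex"
  assume "u \<in> sobolev k" "v \<in> sobolev k" "w \<in> sobolev k"
  then have "(\<lambda>\<xi>. weight \<xi> powr k * (cmod (fourier_coeff (u - v) \<xi>))\<^sup>2) summable_on UNIV"
    "(\<lambda>\<xi>. weight \<xi> powr k * (cmod (fourier_coeff (w - v) \<xi>))\<^sup>2) summable_on UNIV"
    by (auto intro!: sobolev_diff_summable)
  from weighted_l2_triangle(2)[OF _ this]
  have "sobolev_norm k (u - w) \<le> sobolev_norm k (u - v) + sobolev_norm k (w - v)"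
    by (simp add: sobolev_norm_weight fourier_coeff_diff)
  also have "sobolev_norm k (w - v) = sobolev_norm k (v - w)"
    by (simp add: sobolev_norm_weight fourier_coeff_diff norm_minus_commute)
  finally show "sobolev_norm k (u - w) \<le> sobolev_norm k (u - v) + sobolev_norm k (v - w)" .
qed

lemma closedin_sobolev_iff:
  "closedin (sobolev_topology k) S \<longleftrightarrow> S \<subseteq> sobolev k \<and>
     (\<forall>u \<in> sobolev k - S. \<exists>e>0. \<forall>v\<in>S. e \<le> sobolev_norm k (u - v))"
proof -
  interpret Metric_space "sobolev k" "\<lambda>u v. sobolev_norm k (u - v)"
    by (rule Metric_space_sobolev)
  show ?thesis
    unfolding sobolev_topology_def closedin_metric disjnt_iff in_mball
    by (auto simp: not_less Ball_def) (meson not_le subsetD)+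
qed

lemma finite_support_sobolev:
  assumes "finite {\<xi>. c \<xi> \<noteq> 0}"
  shows "coeff_distribution c \<in> sobolev k"
proof -
  obtain C where C: "\<And>\<xi>. cmod (c \<xi>) * weight \<xi> ^ 0 \<le> C"
    using rapidly_decreasingE[OF finite_support_rapidly_decreasing[OF assms]] by blast
  have "polynomial_growth c"
    by (rule polynomial_growthI[of _ C 0]) (use C in simp)
  moreover have "(\<lambda>\<xi>. weight \<xi> powr k * (cmod (c \<xi>))\<^sup>2) summable_on UNIV"
    by (rule finite_nonzero_values_imp_summable_on) (rule finite_subset[OF _ assms], auto)
  ultimately show ?thesis
    by (simp add: sobolev_iff coeff_distribution_in_distributions)
qed

text \<open>The squared error is the tail of a convergent sum, which is made smaller than the square
  of \<open>e\<close>.\<close>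

lemma sobolev_truncation:
  assumes f: "f \<in> sobolev k" and "0 < e"
  obtains A where "finite A"
    "sobolev_norm k (f - coeff_distribution (\<lambda>\<xi>. if \<xi> \<in> A then fourier_coeff f \<xi> else 0)) < e"
proof -
  define g where "g \<xi> = weight \<xi> powr k * (cmod (fourier_coeff f \<xi>))\<^sup>2" for \<xi>
  have g: "g summable_on UNIV" using f by (simp add: sobolev_iff g_def[abs_def])
  have "\<forall>\<^sub>F A in finite_subsets_at_top UNIV. infsum g UNIV - e\<^sup>2 < sum g A"
    using \<open>0 < e\<close> by (intro order_tendstoD[OF infsum_tendsto[OF g]]) simp
  then obtain A where A: "finite A" "infsum g UNIV - e\<^sup>2 < sum g A"
    unfolding eventually_finite_subsets_at_top by blast
  have "(\<Sum>\<^sub>\<infinity>\<xi>. weight \<xi> powr k * (cmod (fourier_coeff f \<xi> - (if \<xi> \<in> A then fourier_coeff f \<xi> else 0)))\<^sup>2)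
      = infsum g (UNIV - A)"
    by (rule infsum_cong_neutral) (auto simp: g_def)
  also have "\<dots> = infsum g UNIV - sum g A"
    using infsum_Diff[OF g, of A] A(1) by simp
  also have "\<dots> < e\<^sup>2" using A(2) by simp
  finally have "sobolev_norm k (f - coeff_distribution (\<lambda>\<xi>. if \<xi> \<in> A then fourier_coeff f \<xi> else 0)) < e"
    unfolding sobolev_norm_weight fourier_coeff_diff fourier_coeff_coeff_distribution
    using \<open>0 < e\<close> real_less_lsqrt by simp
  with A(1) show ?thesis by (rule that)
qed

text \<open>A nonzero coefficient of \<open>u\<close> at some \<xi> in \<open>Z\<close> alone keeps
  \<open>u\<close> at a positive distance from the set.\<close>

lemma closedin_sobolev_vanishing_coeffs:
  "closedin (sobolev_topology k) {f \<in> sobolev k. \<forall>\<xi>\<in>Z. fourier_coeff f \<xi> = 0}"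
  unfolding closedin_sobolev_iff
proof (intro conjI ballI)
  fix u
  assume "u \<in> sobolev k - {f \<in> sobolev k. \<forall>\<xi>\<in>Z. fourier_coeff f \<xi> = 0}"
  then obtain \<xi> where u: "u \<in> sobolev k" and \<xi>: "\<xi> \<in> Z" "fourier_coeff u \<xi> \<noteq> 0" by blast
  define e where "e = sqrt (weight \<xi> powr k) * cmod (fourier_coeff u \<xi>)"
  have "0 < e" using \<xi> by (simp add: e_def)
  moreover have "e \<le> sobolev_norm k (u - v)"
    if "v \<in> {f \<in> sobolev k. \<forall>\<xi>\<in>Z. fourier_coeff f \<xi> = 0}" for v
    using fourier_coeff_le_sobolev_norm[OF u, of v \<xi>] that \<xi> by (simp add: e_def)
  ultimately show "\<exists>e>0. \<forall>v\<in>{f \<in> sobolev k. \<forall>\<xi>\<in>Z. fourier_coeff f \<xi> = 0}. e \<le> sobolev_norm k (u - v)"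
    by blast
qed auto

subsection \<open>The equivalence\<close>

text \<open>A nonzero integer vector has \<open>l1_norm\<close> at least 1, which absorbs the
  summand 1 of the weight.\<close>

lemma l1_norm_weight:
  fixes \<xi> :: "int ^ 'n"
  assumes "\<xi> \<noteq> 0"
  shows "weight \<xi> \<le> 2 * (l1_norm \<xi>)\<^sup>2" "(l1_norm \<xi>)\<^sup>2 \<le> (real CARD('n))\<^sup>2 * weight \<xi>" "0 < l1_norm \<xi>"
proof -
  obtain j where "\<xi> $ j \<noteq> 0" using assms by (auto simp: vec_eq_iff)
  then have "1 \<le> \<bar>real_of_int (\<xi> $ j)\<bar>" by linarith
  also have "\<dots> \<le> l1_norm \<xi>"
    unfolding l1_norm_def by (intro member_le_sum) auto
  finally have l1: "1 \<le> l1_norm \<xi>" .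
  then show "0 < l1_norm \<xi>" by simp
  have "l2_norm \<xi> \<le> l1_norm \<xi>"
    unfolding l2_norm_def l1_norm_def
    using norm_le_l1_cart[of "freq_vec \<xi>"] by (simp add: freq_vec_def)
  then have "(l2_norm \<xi>)\<^sup>2 \<le> (l1_norm \<xi>)\<^sup>2" by (intro power_mono) (auto simp: l2_norm_def)
  moreover have "1 \<le> (l1_norm \<xi>)\<^sup>2" using l1 by simp
  ultimately show "weight \<xi> \<le> 2 * (l1_norm \<xi>)\<^sup>2" by (simp add: weight_def)
  have "\<bar>real_of_int (\<xi> $ j)\<bar> \<le> sqrt (weight \<xi>)" for j
    using component_le_weight[of \<xi> j] by (intro real_le_rsqrt) simp
  then have "l1_norm \<xi> \<le> real CARD('n) * sqrt (weight \<xi>)"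
    unfolding l1_norm_def using sum_bounded_above[of UNIV "\<lambda>j. \<bar>real_of_int (\<xi> $ j)\<bar>"] by simp
  then have "(l1_norm \<xi>)\<^sup>2 \<le> (real CARD('n) * sqrt (weight \<xi>))\<^sup>2"
    using l1 by (intro power_mono) auto
  then show "(l1_norm \<xi>)\<^sup>2 \<le> (real CARD('n))\<^sup>2 * weight \<xi>"
    by (simp add: power_mult_distrib)
qed

text \<open>Powers are increasing or decreasing according to the sign of \<open>s\<close>, so the
  two cases use opposite comparisons from \<open>l1_norm_weight\<close>.\<close>

lemma l1_norm_powr_ge:
  obtains c where "0 < c"
    "\<And>\<xi> :: int ^ 'n. \<xi> \<noteq> 0 \<Longrightarrow> c * weight \<xi> powr (s / 2) \<le> l1_norm \<xi> powr s"
proof (cases "0 \<le> s")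
  case True
  have "(1 / 2) powr (s / 2) * weight \<xi> powr (s / 2) \<le> l1_norm \<xi> powr s" if "\<xi> \<noteq> 0" for \<xi> :: "int ^ 'n"
  proof -
    have "(1 / 2) powr (s / 2) * weight \<xi> powr (s / 2) = (weight \<xi> / 2) powr (s / 2)"
      by (simp add: powr_divide)
    also have "\<dots> \<le> ((l1_norm \<xi>)\<^sup>2) powr (s / 2)"
      using l1_norm_weight[OF that] True by (intro powr_mono2) auto
    also have "\<dots> = l1_norm \<xi> powr s"
      using l1_norm_weight(3)[OF that] by (simp add: powr_powr flip: powr_numeral)
    finally show ?thesis .
  qed
  then show ?thesis using that[of "(1 / 2) powr (s / 2)"] by simp
next
  case False
  have "((real CARD('n))\<^sup>2) powr (s / 2) * weight \<xi> powr (s / 2) \<le> l1_norm \<xi> powr s"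
    if "\<xi> \<noteq> 0" for \<xi> :: "int ^ 'n"
  proof -
    have "((real CARD('n))\<^sup>2) powr (s / 2) * weight \<xi> powr (s / 2) = ((real CARD('n))\<^sup>2 * weight \<xi>) powr (s / 2)"
      by (simp add: powr_mult)
    also have "\<dots> \<le> ((l1_norm \<xi>)\<^sup>2) powr (s / 2)"
      using l1_norm_weight[OF that] False by (intro powr_mono2') auto
    also have "\<dots> = l1_norm \<xi> powr s"
      using l1_norm_weight(3)[OF that] by (simp add: powr_powr flip: powr_numeral)
    finally show ?thesis .
  qed
  then show ?thesis using that[of "((real CARD('n))\<^sup>2) powr (s / 2)"] by simp
qed

lemma lower_bound_weight_iff:
  fixes p :: "int ^ 'n \<Rightarrow> complex"
  shows "(\<exists>K>0. \<forall>\<xi>. \<xi> \<noteq> 0 \<and> p \<xi> \<noteq> 0 \<longrightarrow> K * l1_norm \<xi> powr s \<le> cmod (p \<xi>))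
    \<longleftrightarrow> (\<exists>K>0. \<forall>\<xi>. p \<xi> \<noteq> 0 \<longrightarrow> K * weight \<xi> powr (s / 2) \<le> cmod (p \<xi>))" (is "?l1 \<longleftrightarrow> ?w")
proof
  assume ?l1
  then obtain K where K: "0 < K" "\<And>\<xi>. \<xi> \<noteq> 0 \<Longrightarrow> p \<xi> \<noteq> 0 \<Longrightarrow> K * l1_norm \<xi> powr s \<le> cmod (p \<xi>)"
    by blast
  obtain c where c: "0 < c" "\<And>\<xi> :: int ^ 'n. \<xi> \<noteq> 0 \<Longrightarrow> c * weight \<xi> powr (s / 2) \<le> l1_norm \<xi> powr s"
    using l1_norm_powr_ge by blast
  \<comment> \<open>The second entry takes care of the frequency 0, which the condition with
    \<open>l1_norm\<close> leaves out and where the weight is 1.\<close>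
  define L where "L = min (K * c) (if p 0 = 0 then 1 else cmod (p 0))"
  have "L * weight \<xi> powr (s / 2) \<le> cmod (p \<xi>)" if "p \<xi> \<noteq> 0" for \<xi>
  proof (cases "\<xi> = 0")
    case True
    have "weight (0 :: int ^ 'n) = 1" by (simp add: weight_def l2_norm_squared)
    then show ?thesis using True that by (simp add: L_def)
  next
    case False
    have "L * weight \<xi> powr (s / 2) \<le> K * (c * weight \<xi> powr (s / 2))"
      unfolding mult.assoc[symmetric] by (intro mult_right_mono) (auto simp: L_def)
    also have "\<dots> \<le> K * l1_norm \<xi> powr s"
      using c(2)[OF False] K(1) by (intro mult_left_mono) auto
    also have "\<dots> \<le> cmod (p \<xi>)" by (rule K(2)[OF False that])
    finally show ?thesis .
  qed
  moreover have "0 < L" using K(1) c(1) by (simp add: L_def)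
  ultimately show ?w by blast
next
  assume ?w
  then obtain K where K: "0 < K" "\<And>\<xi>. p \<xi> \<noteq> 0 \<Longrightarrow> K * weight \<xi> powr (s / 2) \<le> cmod (p \<xi>)"
    by blast
  \<comment> \<open>An upper bound for the power \<open>s\<close> is needed here; it is the
    reciprocal of the lower bound for the power \<open>- s\<close>.\<close>
  obtain c where c: "0 < c" "\<And>\<xi> :: int ^ 'n. \<xi> \<noteq> 0 \<Longrightarrow> c * weight \<xi> powr (- s / 2) \<le> l1_norm \<xi> powr (- s)"
    using l1_norm_powr_ge by blast
  have "K * c * l1_norm \<xi> powr s \<le> cmod (p \<xi>)" if "\<xi> \<noteq> 0" "p \<xi> \<noteq> 0" for \<xi>
  proof -
    have "c * l1_norm \<xi> powr s \<le> weight \<xi> powr (s / 2)"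
      using c(2)[OF that(1)] l1_norm_weight(3)[OF that(1)]
      by (simp add: powr_minus field_simps)
    then have "K * (c * l1_norm \<xi> powr s) \<le> K * weight \<xi> powr (s / 2)"
      using K(1) by (intro mult_left_mono) auto
    also have "\<dots> \<le> cmod (p \<xi>)" by (rule K(2)[OF that(2)])
    finally show ?thesis by (simp add: mult.assoc)
  qed
  then show ?l1 using K(1) c(1) mult_pos_pos by blast
qed

text \<open>The hypothesis bounds \<open>inverse (p \<xi>)\<close> by a multiple of
  \<open>weight \<xi> powr (- s / 2)\<close> at every frequency, so dividing by \<open>p\<close>
  gains \<open>s\<close> orders of Sobolev regularity.\<close>

lemma lower_bound_imp_solvable:
  fixes p :: "int ^ 'n \<Rightarrow> complex"
  assumes p: "polynomial_growth p" and "0 < K"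
    and K: "\<And>\<xi>. p \<xi> \<noteq> 0 \<Longrightarrow> K * weight \<xi> powr (s / 2) \<le> cmod (p \<xi>)"
    and f: "f \<in> sobolev k" "\<And>\<xi>. p \<xi> = 0 \<Longrightarrow> fourier_coeff f \<xi> = 0"
  shows "\<exists>u\<in>sobolev (k + s). multiplier p u = f"
proof -
  define c where "c \<xi> = inverse (p \<xi>) * fourier_coeff f \<xi>" for \<xi> \<comment> \<open>\<open>0\<close> where \<open>p \<xi> = 0\<close>\<close>
  have inv: "cmod (inverse (p \<xi>)) \<le> (1 / K) * weight \<xi> powr (- s / 2)" for \<xi>
  proof (cases "p \<xi> = 0")
    case False
    have "0 < K * weight \<xi> powr (s / 2)" using \<open>0 < K\<close> by simp
    from le_imp_inverse_le[OF K[OF False] this] show ?thesis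
      by (simp add: norm_inverse norm_divide powr_minus inverse_eq_divide)
  qed (use \<open>0 < K\<close> in simp)
  have "polynomial_growth (\<lambda>\<xi>. inverse (p \<xi>))"
  proof (rule polynomial_growthI)
    fix \<xi>
    show "cmod (inverse (p \<xi>)) \<le> (1 / K) * weight \<xi> ^ nat \<lceil>- s / 2\<rceil>"
      using \<open>0 < K\<close> by (intro order_trans[OF inv] mult_left_mono weight_powr_le) simp
  qed
  moreover have "f \<in> distributions" using f(1) by (simp add: sobolev_iff)
  ultimately have c: "polynomial_growth c"
    unfolding c_def by (intro polynomial_growth_mult polynomial_growth_fourier_coeff)
  have "(\<lambda>\<xi>. weight \<xi> powr (k + s) * (cmod (c \<xi>))\<^sup>2) summable_on UNIV"
  proof (rule summable_on_comparison_test)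
    show "(\<lambda>\<xi>. (1 / K)\<^sup>2 * (weight \<xi> powr k * (cmod (fourier_coeff f \<xi>))\<^sup>2)) summable_on UNIV"
      using f(1) by (intro summable_on_cmult_right) (simp add: sobolev_iff)
    fix \<xi>
    have "(cmod (c \<xi>))\<^sup>2 \<le> ((1 / K) * weight \<xi> powr (- s / 2) * cmod (fourier_coeff f \<xi>))\<^sup>2"
      unfolding c_def norm_mult by (intro power_mono mult_right_mono inv) auto
    also have "\<dots> = (1 / K)\<^sup>2 * (weight \<xi> powr (- s) * (cmod (fourier_coeff f \<xi>))\<^sup>2)"
      by (simp add: power_mult_distrib power2_eq_square flip: powr_add)
    finally have "weight \<xi> powr (k + s) * (cmod (c \<xi>))\<^sup>2
        \<le> weight \<xi> powr (k + s) * ((1 / K)\<^sup>2 * (weight \<xi> powr (- s) * (cmod (fourier_coeff f \<xi>))\<^sup>2))"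
      by (rule mult_left_mono) simp
    also have "\<dots> = (1 / K)\<^sup>2 * ((weight \<xi> powr (k + s) * weight \<xi> powr (- s)) * (cmod (fourier_coeff f \<xi>))\<^sup>2)"
      by (simp add: mult_ac)
    finally show "weight \<xi> powr (k + s) * (cmod (c \<xi>))\<^sup>2
        \<le> (1 / K)\<^sup>2 * (weight \<xi> powr k * (cmod (fourier_coeff f \<xi>))\<^sup>2)"
      by (simp flip: powr_add)
  qed auto
  then have "coeff_distribution c \<in> sobolev (k + s)"
    by (simp add: sobolev_iff coeff_distribution_in_distributions c)
  moreover have "multiplier p (coeff_distribution c) = f"
  proof (rule multiplier_eqI)
    fix \<xi>
    show "fourier_coeff f \<xi> = p \<xi> * fourier_coeff (coeff_distribution c) \<xi>"
      using f(2)[of \<xi>] by (cases "p \<xi> = 0") (simp_all add: c_def)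
  qed (use f(1) in \<open>simp_all add: p c coeff_distribution_in_distributions sobolev_iff\<close>)
  ultimately show ?thesis by blast
qed

lemma solvable_imp_lower_bound:
  fixes p :: "int ^ 'n \<Rightarrow> complex"
  assumes p: "polynomial_growth p"
    and solvable: "\<And>f. f \<in> sobolev 0 \<Longrightarrow> (\<And>\<xi>. p \<xi> = 0 \<Longrightarrow> fourier_coeff f \<xi> = 0) \<Longrightarrow>
      \<exists>u\<in>sobolev s. multiplier p u = f"
  shows "\<exists>K>0. \<forall>\<xi>. p \<xi> \<noteq> 0 \<longrightarrow> K * weight \<xi> powr (s / 2) \<le> cmod (p \<xi>)"
proof (rule ccontr)
  assume neg: "\<not> ?thesis"
  \<comment> \<open>The ratio that the claim bounds from below; its negation says that \<rho> takes
    arbitrarily small positive values.\<close>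
  define \<rho> where "\<rho> \<xi> = cmod (p \<xi>) * weight \<xi> powr (- s / 2)" for \<xi>
  have small: "\<exists>\<xi>. 0 < \<rho> \<xi> \<and> \<rho> \<xi> < K" if "0 < K" for K
  proof -
    obtain \<xi> where "p \<xi> \<noteq> 0" "cmod (p \<xi>) < K * weight \<xi> powr (s / 2)"
    proof -
      from neg have "\<forall>K>0. \<exists>\<xi>. p \<xi> \<noteq> 0 \<and> cmod (p \<xi>) < K * weight \<xi> powr (s / 2)"
        by (simp add: not_le)
      with \<open>0 < K\<close> show ?thesis using that by blast
    qed
    then have "0 < \<rho> \<xi>" "\<rho> \<xi> < K"
      by (simp_all add: \<rho>_def powr_minus field_simps)
    then show ?thesis by blast
  qed
  \<comment> \<open>The geometric bound makes the squares of \<rho> summable along the sequence, and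
    strict decrease makes the frequencies distinct.\<close>
  have "\<exists>x. \<forall>i. (0 < \<rho> (x i) \<and> \<rho> (x i) < (1 / 2) ^ i) \<and> \<rho> (x (Suc i)) < \<rho> (x i)"
  proof (rule dependent_nat_choice)
    show "\<exists>\<xi>. 0 < \<rho> \<xi> \<and> \<rho> \<xi> < (1 / 2) ^ 0" using small[of 1] by simp
    fix \<xi> i
    assume "0 < \<rho> \<xi> \<and> \<rho> \<xi> < (1 / 2) ^ i"
    then show "\<exists>\<eta>. (0 < \<rho> \<eta> \<and> \<rho> \<eta> < (1 / 2) ^ Suc i) \<and> \<rho> \<eta> < \<rho> \<xi>"
      using small[of "min (\<rho> \<xi>) ((1 / 2) ^ Suc i)"] by auto
  qed
  then obtain x where x: "\<And>i. 0 < \<rho> (x i)" "\<And>i. \<rho> (x i) < (1 / 2) ^ i" "\<And>i. \<rho> (x (Suc i)) < \<rho> (x i)"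
    by blast
  have "strict_mono (\<lambda>i. - \<rho> (x i))"
    using x(3) by (simp add: strict_mono_Suc_iff)
  then have inj: "inj x"
    using strict_mono_imp_inj_on[of "\<lambda>i. - \<rho> (x i)" UNIV] by (auto simp: inj_on_def)
  \<comment> \<open>Dividing by \<open>p\<close> leaves \<open>weight \<xi> powr (- s / 2)\<close>,
    so any solution has infinitely many terms equal to 1 in its H^s sum, while
    \<open>cmod (c \<xi>)\<close> is \<open>\<rho> \<xi>\<close> on the sequence.\<close>
  define c where "c \<xi> = (if \<xi> \<in> range x then p \<xi> * complex_of_real (weight \<xi> powr (- s / 2)) else 0)" for \<xi>
  have cmod_c: "cmod (c \<xi>) = (if \<xi> \<in> range x then \<rho> \<xi> else 0)" for \<xi>
    by (simp add: c_def \<rho>_def norm_mult)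
  have "\<rho> (x i) \<le> 1" for i
    using x(2)[of i] power_le_one[of "1 / 2 :: real" i] by simp
  then have c: "polynomial_growth c"
    by (intro polynomial_growthI[of _ 1 0]) (auto simp: cmod_c)
  define f where "f = coeff_distribution c"
  have f: "f \<in> distributions" "\<And>\<xi>. fourier_coeff f \<xi> = c \<xi>"
    by (simp_all add: f_def coeff_distribution_in_distributions c)
  have "(\<lambda>i. (\<rho> (x i))\<^sup>2) summable_on UNIV"
  proof (subst summable_on_UNIV_nonneg_real_iff)
    show "summable (\<lambda>i. (\<rho> (x i))\<^sup>2)"
    proof (rule summable_comparison_test)
      show "summable (\<lambda>i. (1 / 2 :: real) ^ i)" by (rule summable_geometric) simp
      have "(\<rho> (x i))\<^sup>2 \<le> (1 / 2) ^ i" for i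
        using mult_mono[OF less_imp_le[OF x(2)[of i]] \<open>\<rho> (x i) \<le> 1\<close>] x(1)[of i]
        by (simp add: power2_eq_square)
      then show "\<exists>N. \<forall>i\<ge>N. norm ((\<rho> (x i))\<^sup>2) \<le> (1 / 2) ^ i" by simp
    qed
  qed simp
  then have "(\<lambda>\<xi>. (cmod (c \<xi>))\<^sup>2) summable_on range x"
    by (subst summable_on_reindex[OF inj]) (simp add: o_def cmod_c)
  then have "(\<lambda>\<xi>. weight \<xi> powr 0 * (cmod (c \<xi>))\<^sup>2) summable_on UNIV"
    by (rule summable_on_cong_neutral[THEN iffD1, rotated -1]) (auto simp: cmod_c)
  then have "f \<in> sobolev 0" by (simp add: sobolev_iff f)
  moreover have "fourier_coeff f \<xi> = 0" if "p \<xi> = 0" for \<xi>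
    using that by (simp add: f c_def)
  ultimately obtain u where u: "u \<in> sobolev s" "multiplier p u = f"
    using solvable by blast
  have "weight \<xi> powr s * (cmod (fourier_coeff u \<xi>))\<^sup>2 = 1" if "\<xi> \<in> range x" for \<xi>
  proof -
    have "0 < \<rho> \<xi>" using that x(1) by blast
    then have "p \<xi> \<noteq> 0" by (auto simp: \<rho>_def)
    moreover have "p \<xi> * fourier_coeff u \<xi> = c \<xi>"
      using multiplier_props(2)[OF p, of u \<xi>] u f(2) by (simp add: sobolev_iff)
    ultimately have "fourier_coeff u \<xi> = complex_of_real (weight \<xi> powr (- s / 2))"
      using that by (simp add: c_def)
    then show ?thesis
      by (simp add: power2_eq_square norm_mult flip: powr_add)
  qed
  then have "(\<lambda>\<xi>. 1 :: real) summable_on range x"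
    using summable_on_subset_banach[of _ UNIV "range x"] u(1)
    by (subst summable_on_cong[of _ _ "\<lambda>\<xi>. weight \<xi> powr s * (cmod (fourier_coeff u \<xi>))\<^sup>2"])
      (auto simp: sobolev_iff)
  then have "(\<lambda>i :: nat. 1 :: real) summable_on UNIV"
    by (simp add: summable_on_reindex[OF inj] o_def)
  then have "summable (\<lambda>i :: nat. 1 :: real)"
    by (rule summable_on_imp_summable)
  then show False by (simp add: summable_const_iff)
qed

text \<open>Here \<open>s\<close> and \<open>k\<close> are independent: the range is taken on the
  maximal domain and always lies in \<open>N\<close>, which is closed, and it contains every
  finitely supported element of \<open>N\<close>.\<close>

lemma closed_range_iff:
  fixes p :: "int ^ 'n \<Rightarrow> complex" and k s :: real
  assumes p: "polynomial_growth p"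
  defines "N \<equiv> {f \<in> sobolev k. \<forall>\<xi>\<in>{\<xi>. p \<xi> = 0}. fourier_coeff f \<xi> = 0}"
  shows "closedin (sobolev_topology k) (sobolev_range (multiplier p) s k)
    \<longleftrightarrow> (\<forall>f\<in>N. \<exists>u\<in>sobolev s. multiplier p u = f)"
proof
  let ?R = "sobolev_range (multiplier p) s k"
  assume closed: "closedin (sobolev_topology k) ?R"
  show "\<forall>f\<in>N. \<exists>u\<in>sobolev s. multiplier p u = f"
  proof
    fix f assume f: "f \<in> N"
    have "f \<in> ?R"
    proof (rule ccontr)
      assume "f \<notin> ?R"
      then obtain e where e: "0 < e" "\<And>v. v \<in> ?R \<Longrightarrow> e \<le> sobolev_norm k (f - v)"
        using closed f unfolding closedin_sobolev_iff N_def by blast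
      obtain A where A: "finite A"
        "sobolev_norm k (f - coeff_distribution (\<lambda>\<xi>. if \<xi> \<in> A then fourier_coeff f \<xi> else 0)) < e"
        using sobolev_truncation f e(1) unfolding N_def by blast
      define g where "g = coeff_distribution (\<lambda>\<xi>. if \<xi> \<in> A then fourier_coeff f \<xi> else 0)"
      \<comment> \<open>Only finitely many quotients occur, so \<open>u\<close> lies in every
        Sobolev space however small \<open>p\<close> is. Where \<open>p\<close> vanishes so does the
        coefficient of \<open>f\<close>, and the quotient is 0 by convention.\<close>
      define u where "u = coeff_distribution (\<lambda>\<xi>. if \<xi> \<in> A then fourier_coeff f \<xi> / p \<xi> else 0)"
      have "g \<in> sobolev k" "u \<in> sobolev s"
        unfolding g_def u_def by (auto intro!: finite_support_sobolev intro: finite_subset[OF _ A(1)])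
      moreover have "multiplier p u = g"
      proof (rule multiplier_eqI[OF p])
        fix \<xi>
        show "fourier_coeff g \<xi> = p \<xi> * fourier_coeff u \<xi>"
          using f by (auto simp: g_def u_def N_def)
      qed (use \<open>g \<in> sobolev k\<close> \<open>u \<in> sobolev s\<close> in \<open>auto simp: sobolev_iff\<close>)
      ultimately have "g \<in> ?R" unfolding sobolev_range_def by blast
      then show False using e(2) A(2) by (fastforce simp: g_def)
    qed
    then show "\<exists>u\<in>sobolev s. multiplier p u = f" unfolding sobolev_range_def by blast
  qed
next
  assume solvable: "\<forall>f\<in>N. \<exists>u\<in>sobolev s. multiplier p u = f"
  have "sobolev_range (multiplier p) s k = N"
  proof (intro set_eqI iffI)
    fix f assume "f \<in> sobolev_range (multiplier p) s k"
    then obtain u where "u \<in> sobolev s" "multiplier p u \<in> sobolev k" "f = multiplier p u"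
      by (auto simp: sobolev_range_def)
    then show "f \<in> N" by (simp add: N_def sobolev_iff multiplier_props p)
  next
    fix f assume "f \<in> N"
    then obtain u where "u \<in> sobolev s" "multiplier p u = f" "f \<in> sobolev k"
      using solvable by (auto simp: N_def)
    then show "f \<in> sobolev_range (multiplier p) s k"
      unfolding sobolev_range_def by blast
  qed
  then show "closedin (sobolev_topology k) (sobolev_range (multiplier p) s k)"
    unfolding N_def by (simp only: closedin_sobolev_vanishing_coeffs)
qed

theorem theorem1p2:
  fixes p :: "int ^ 'n \<Rightarrow> complex" and m r :: real
  assumes "symbol_of_order m p" and "r \<ge> 0"
  defines "cond1 \<equiv> (\<exists>K>0. \<forall>\<xi>. \<xi> \<noteq> 0 \<and> p \<xi> \<noteq> 0 \<longrightarrow> cmod (p \<xi>) \<ge> K * l1_norm \<xi> powr (m - r))"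
    and "cond2 \<equiv> (\<forall>k. \<forall>f \<in> sobolev k \<inter> annihilator (smooth_kernel (transpose_op (multiplier p))).
           \<exists>u \<in> sobolev (k + m - r). multiplier p u = f)"
    and "cond3 \<equiv> (\<forall>k. closedin (sobolev_topology k) (sobolev_range (multiplier p) (k + m - r) k))"
  shows "(cond1 \<longleftrightarrow> cond2) \<and> (cond2 \<longleftrightarrow> cond3)"
proof
  have p: "polynomial_growth p" by (rule polynomial_growth_symbol[OF assms(1)])
  have ann: "sobolev k \<inter> annihilator (smooth_kernel (transpose_op (multiplier p)))
      = {f \<in> sobolev k. \<forall>\<xi>\<in>{\<xi>. p \<xi> = 0}. fourier_coeff f \<xi> = 0}" for k
    unfolding annihilator_smooth_kernel[OF p] by (auto simp: sobolev_iff)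
  show "cond2 \<longleftrightarrow> cond3"
    unfolding cond2_def cond3_def ann closed_range_iff[OF p] ..
  have cond1: "cond1 \<longleftrightarrow> (\<exists>K>0. \<forall>\<xi>. p \<xi> \<noteq> 0 \<longrightarrow> K * weight \<xi> powr ((m - r) / 2) \<le> cmod (p \<xi>))"
    unfolding cond1_def by (rule lower_bound_weight_iff)
  show "cond1 \<longleftrightarrow> cond2"
  proof
    assume cond1
    then obtain K where K: "0 < K" "\<And>\<xi>. p \<xi> \<noteq> 0 \<Longrightarrow> K * weight \<xi> powr ((m - r) / 2) \<le> cmod (p \<xi>)"
      unfolding cond1 by blast
    show cond2
      unfolding cond2_def ann
    proof (intro allI ballI)
      fix k f
      assume "f \<in> {f \<in> sobolev k. \<forall>\<xi>\<in>{\<xi>. p \<xi> = 0}. fourier_coeff f \<xi> = 0}"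
      then have "\<exists>u\<in>sobolev (k + (m - r)). multiplier p u = f"
        by (intro lower_bound_imp_solvable[OF p K]) auto
      then show "\<exists>u\<in>sobolev (k + m - r). multiplier p u = f"
        by (simp only: add_diff_eq)
    qed
  next
    assume cond2
    \<comment> \<open>Specialisation to k = 0, which suffices because the lower bound does not
      depend on k.\<close>
    then have "\<forall>f\<in>{f \<in> sobolev 0. \<forall>\<xi>\<in>{\<xi>. p \<xi> = 0}. fourier_coeff f \<xi> = 0}.
        \<exists>u\<in>sobolev (0 + m - r). multiplier p u = f"
      unfolding cond2_def ann by (rule spec)
    then have "\<forall>f\<in>{f \<in> sobolev 0. \<forall>\<xi>\<in>{\<xi>. p \<xi> = 0}. fourier_coeff f \<xi> = 0}.
        \<exists>u\<in>sobolev (m - r). multiplier p u = f"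
      by (simp only: add_0_left)
    then show cond1
      unfolding cond1 by (intro solvable_imp_lower_bound[OF p]) blast
  qed
qed

end
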